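(* Let $f:\mathbb R^{n_1\times\cdots\times n_d}\to\mathbb R$ be smooth, let $\mathbf r=(r_1,\dots,r_d)$ with $1\le r_k\le n_k$, and let $\tilde g=f\circ\tilde\varphi$ on $\mathcal M^{\mathrm{Tucker}}$ and $g=f\circ\varphi$ on $\mathcal M$ (all defined in the context). If $(\tilde{\mathcal G},\tilde{\mathbf U}_1,\dots,\tilde{\mathbf U}_d)\in\mathcal M^{\mathrm{Tucker}}$ is second-order stationary for $\tilde g$, then the point $x\in\mathcal M$ represented by $(\tilde{\mathcal G}\times_{k=1}^d\mathbf R_k^{-1},\tilde{\mathbf U}_1\mathbf R_1,\dots,\tilde{\mathbf U}_d\mathbf R_d)$ is second-order stationary for $g$, where $\mathbf R_k\in\mathrm{GL}(r_k)$ satisfies $\tilde{\mathbf U}_k\mathbf R_k\in\mathrm{St}(r_k,n_k)$ for $k=1,\dots,d$. Furthermore, $\varphi(S_2)=\tilde\varphi(\tilde S_2)$, where $S_2\subseteq\mathcal M$ is the set of all second-order stationary points of $g$ and $\tilde S_2\subseteq\mathcal M^{\mathrm{Tucker}}$ is the set of all second-order stationary points of $\tilde g$.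
   Context: $\mathrm{Sym}(n)$: real symmetric $n\times n$ matrices. $\mathrm{Gr}(s,n)=\{\mathbf P\in\mathrm{Sym}(n):\mathrm{rank}(\mathbf P)=s,\mathbf P=\mathbf P^2\}$. $\mathrm{St}(r,n)=\{\mathbf U\in\mathbb R^{n\times r}:\mathbf U^\top\mathbf U=\mathbf I_r\}$. $\mathrm{GL}(r)$: invertible $r\times r$ real matrices. The $k$-mode product $\mathcal X\times_k\mathbf A$ ($\mathbf A\in\mathbb R^{M\times n_k}$) has entries $\sum_{i_k}\mathbf A(j,i_k)\mathcal X(i_1,\dots,i_d)$; $\times_{k=1}^d$ denotes successive products over all modes. $\mathcal M=\{(\mathcal X,\mathbf P_1,\dots,\mathbf P_d):\mathcal X\in\mathbb R^{n_1\times\cdots\times n_d},\ \mathbf P_k\in\mathrm{Gr}(n_k-r_k,n_k),\ \mathcal X\times_k\mathbf P_k=0\ \forall k\}$, an embedded submanifold of $\mathcal E=\mathbb R^{n_1\times\cdots\times n_d}\times\mathrm{Sym}(n_1)\times\cdots\times\mathrm{Sym}(n_d)$, with the Riemannian metric induced by the Euclidean (sum of Frobenius) inner product of $\mathcal E$, and $\varphi(\mathcal X,\mathbf P_1,\dots,\mathbf P_d)=\mathcal X$. The point of $\mathcal M$ represented by $(\mathcal G,\mathbf U_1,\dots,\mathbf U_d)$, $\mathcal G\in\mathbb R^{r_1\times\cdots\times r_d}$, $\mathbf U_k\in\mathrm{St}(r_k,n_k)$, is given by $\mathcal X=\mathcal G\times_{k=1}^d\mathbf U_k$, $\mathbf P_k=\mathbf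 I_{n_k}-\mathbf U_k\mathbf U_k^\top$. A point $x\in\mathcal M$ is second-order stationary for $g$ if the Riemannian gradient satisfies $\mathrm{grad}\,g(x)=0$ and the Riemannian Hessian $\mathrm{Hess}\,g(x)$ is positive semidefinite on the tangent space at $x$. $\mathcal M^{\mathrm{Tucker}}=\mathbb R^{r_1\times\cdots\times r_d}\times\mathbb R^{n_1\times r_1}\times\cdots\times\mathbb R^{n_d\times r_d}$ (Euclidean space) with $\tilde\varphi(\tilde{\mathcal G},\tilde{\mathbf U}_1,\dots,\tilde{\mathbf U}_d)=\tilde{\mathcal G}\times_{k=1}^d\tilde{\mathbf U}_k$; a point is second-order stationary for $\tilde g$ if $\nabla\tilde g=0$ and $\nabla^2\tilde g$ is positive semidefinite there.
   Formalization: In the equality of images, the set of second-order stationary points of g̃ is restricted to points whose factors Ũ_k all have full column rank (so that R_k exist); without this it fails, e.g. for f(X) = -‖X‖² at the zero point. *)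

theory Defs
  imports "HOL-Analysis.Analysis"
begin

text \<open>
  The modes are the elements of a finite type \<open>'d\<close>, so that the order of a tensor is
  \<open>CARD('d)\<close>. As the dimension varies with the mode, mode \<open>k\<close> is indexed by a
  subset \<open>I k\<close> of one finite type \<open>'n\<close>, and its dimension is \<open>card (I k)\<close>. Tensors
  and matrices whose sizes are given by such index sets are the arrays over the full index types
  that vanish off the prescribed index set. This zero-padding is linear and preserves the
  Frobenius inner product, products and rank; it makes each space of tensors, of matrices or of
  tuples of these a linear subspace of a Euclidean space with the induced inner product.
\<close>

section \<open>Matrices and tensors\<close>

definition mats :: "'n::finite set \<Rightarrow> 'n set \<Rightarrow> (real^'n^'n) set" where
  "mats A B = {M. \<forall>i j. M $ i $ j \<noteq> 0 \<longrightarrow> i \<in> A \<and> j \<in> B}"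

definition idm :: "'n::finite set \<Rightarrow> real^'n^'n" where
  "idm A = (\<chi> i j. if i = j \<and> i \<in> A then 1 else 0)"

definition Gr :: "nat \<Rightarrow> 'n::finite set \<Rightarrow> (real^'n^'n) set" where
  "Gr s A = {P \<in> mats A A. transpose P = P \<and> rank P = s \<and> P = P ** P}"

text \<open>\<open>St B A\<close> consists of matrices with rows indexed by \<open>A\<close> and columns by \<open>B\<close>.\<close>

definition St :: "'n::finite set \<Rightarrow> 'n set \<Rightarrow> (real^'n^'n) set" where
  "St B A = {U \<in> mats A B. transpose U ** U = idm B}"

definition is_inverse_on :: "'n::finite set \<Rightarrow> real^'n^'n \<Rightarrow> real^'n^'n \<Rightarrow> bool" where
  "is_inverse_on B R S \<longleftrightarrow> S \<in> mats B B \<and> R ** S = idm B \<and> S ** R = idm B"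

definition GL :: "'n::finite set \<Rightarrow> (real^'n^'n) set" where
  "GL B = {R \<in> mats B B. \<exists>S. is_inverse_on B R S}"

definition inv_on :: "'n::finite set \<Rightarrow> real^'n^'n \<Rightarrow> real^'n^'n" where
  "inv_on B R = (THE S. is_inverse_on B R S)"

definition tensors :: "('d::finite \<Rightarrow> 'n::finite set) \<Rightarrow> (real^('d \<Rightarrow> 'n)) set" where
  "tensors I = {X. \<forall>i. X $ i \<noteq> 0 \<longrightarrow> (\<forall>k. i k \<in> I k)}"

text \<open>
  The sum below runs over the whole type; because of the zero-padding only the indices of mode
  \<open>k\<close> contribute.
\<close>

definition mode_prod ::
  "real^('d::finite \<Rightarrow> 'n::finite) \<Rightarrow> 'd \<Rightarrow> real^'n^'n \<Rightarrow> real^('d \<Rightarrow> 'n)" where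
  "mode_prod X k A = (\<chi> j. \<Sum>i\<in>UNIV. A $ j k $ i * X $ (j(k := i)))"

text \<open>
  The successive products over all modes. Products in different modes commute
  (\<open>mode_prod_commute\<close>), so the order of the modes does not matter and the fold is well defined.
\<close>

definition multi_prod ::
  "real^('d::finite \<Rightarrow> 'n::finite) \<Rightarrow> (real^'n^'n)^'d \<Rightarrow> real^('d \<Rightarrow> 'n)" where
  "multi_prod X A = Finite_Set.fold (\<lambda>k Y. mode_prod Y k (A $ k)) X UNIV"

lemma mode_prod_commute:
  assumes "k \<noteq> l"
  shows "mode_prod (mode_prod X k A) l B = mode_prod (mode_prod X l B) k A"
proof -
  have "(\<Sum>i\<in>UNIV. B $ j l $ i * (\<Sum>i'\<in>UNIV. A $ j k $ i' * X $ (j(l := i, k := i')))) =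
        (\<Sum>i'\<in>UNIV. A $ j k $ i' * (\<Sum>i\<in>UNIV. B $ j l $ i * X $ (j(k := i', l := i))))" for j
    unfolding sum_distrib_left fun_upd_twist[OF assms]
    by (subst sum.swap) (simp add: mult.left_commute)
  then show ?thesis
    using assms by (simp add: mode_prod_def vec_eq_iff)
qed

lemma comp_fun_commute_mode_prod: "comp_fun_commute (\<lambda>k Y. mode_prod Y k (A $ k))"
proof
  fix k l
  show "(\<lambda>Y. mode_prod Y l (A $ l)) \<circ> (\<lambda>Y. mode_prod Y k (A $ k)) =
        (\<lambda>Y. mode_prod Y k (A $ k)) \<circ> (\<lambda>Y. mode_prod Y l (A $ l))"
    by (cases "k = l") (auto simp: fun_eq_iff mode_prod_commute)
qed

section \<open>Smoothness\<close>

text \<open>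
  \<open>Ck_on m W S F\<close>: the map \<open>F\<close> is \<open>m\<close> times continuously differentiable on \<open>S\<close>, where \<open>S\<close> is meant
  to be a relatively open subset of the linear subspace \<open>W\<close>. The derivative within \<open>S\<close> is then
  determined in the directions of \<open>W\<close>, and its values in these directions are required
  to be of class \<open>m - 1\<close>. Values of \<open>F\<close> off \<open>S\<close> are irrelevant.
\<close>

primrec Ck_on :: "nat \<Rightarrow> 'a::real_normed_vector set \<Rightarrow> 'a set \<Rightarrow>
    ('a \<Rightarrow> 'b::real_normed_vector) \<Rightarrow> bool" where
  "Ck_on 0 W S F \<longleftrightarrow> continuous_on S F"
| "Ck_on (Suc m) W S F \<longleftrightarrow>
     (\<exists>F'. (\<forall>x\<in>S. (F has_derivative F' x) (at x within S)) \<and>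
           (\<forall>h\<in>W. Ck_on m W S (\<lambda>x. F' x h)))"

definition smooth_on :: "'a::real_normed_vector set \<Rightarrow> 'a set \<Rightarrow>
    ('a \<Rightarrow> 'b::real_normed_vector) \<Rightarrow> bool" where
  "smooth_on W S F \<longleftrightarrow> (\<forall>m. Ck_on m W S F)"

section \<open>Second-order stationarity on a linear subspace\<close>

definition grad :: "'a::euclidean_space set \<Rightarrow> ('a \<Rightarrow> real) \<Rightarrow> 'a \<Rightarrow> 'a" where
  "grad W g x = (THE w. w \<in> W \<and> (g has_derivative (\<lambda>h. w \<bullet> h)) (at x within W))"

definition hess :: "'a::euclidean_space set \<Rightarrow> ('a \<Rightarrow> real) \<Rightarrow> 'a \<Rightarrow> 'a \<Rightarrow> 'a" where
  "hess W g x h = (THE v. \<exists>H. (grad W g has_derivative H) (at x within W) \<and> v = H h)"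

definition second_order_stationary :: "'a::euclidean_space set \<Rightarrow> ('a \<Rightarrow> real) \<Rightarrow> 'a \<Rightarrow> bool" where
  "second_order_stationary W g x \<longleftrightarrow>
     x \<in> W \<and> grad W g x = 0 \<and> (\<forall>h\<in>W. 0 \<le> h \<bullet> hess W g x h)"

section \<open>Second-order stationarity on an embedded submanifold of a Euclidean space\<close>

text \<open>
  The metric is the one induced by the ambient inner product. All notions only use the values of
  the functions on \<open>M\<close>, and agree for any linear subspace of the ambient space containing \<open>M\<close>.
\<close>

definition curve_through ::
  "'a::euclidean_space set \<Rightarrow> 'a \<Rightarrow> 'a \<Rightarrow> (real \<Rightarrow> 'a) \<Rightarrow> bool" where
  "curve_through M x v c \<longleftrightarrow>
     (\<exists>e>0. smooth_on UNIV {-e<..<e} c \<and> c ` {-e<..<e} \<subseteq> M) \<and>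
     c 0 = x \<and> (c has_vector_derivative v) (at 0)"

definition tangent_space :: "'a::euclidean_space set \<Rightarrow> 'a \<Rightarrow> 'a set" where
  "tangent_space M x = {v. \<exists>c. curve_through M x v c}"

text \<open>The differential along \<open>M\<close> of a map into a Euclidean space.\<close>

definition mdiff :: "'a::euclidean_space set \<Rightarrow> ('a \<Rightarrow> 'b::euclidean_space) \<Rightarrow> 'a \<Rightarrow> 'a \<Rightarrow> 'b" where
  "mdiff M F x v =
     (THE w. \<forall>c. curve_through M x v c \<longrightarrow> ((\<lambda>t. F (c t)) has_vector_derivative w) (at 0))"

definition riem_grad :: "'a::euclidean_space set \<Rightarrow> ('a \<Rightarrow> real) \<Rightarrow> 'a \<Rightarrow> 'a" where
  "riem_grad M g x =
     (THE w. w \<in> tangent_space M x \<and> (\<forall>v\<in>tangent_space M x. w \<bullet> v = mdiff M g x v))"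

definition orth_proj :: "'a::euclidean_space set \<Rightarrow> 'a \<Rightarrow> 'a" where
  "orth_proj T v = (THE w. w \<in> T \<and> (\<forall>z\<in>T. (v - w) \<bullet> z = 0))"

text \<open>
  The Levi-Civita connection of the induced metric is the tangential part of the ambient
  derivative of a vector field; the Hessian is the covariant derivative of the gradient.
\<close>

definition riem_hess :: "'a::euclidean_space set \<Rightarrow> ('a \<Rightarrow> real) \<Rightarrow> 'a \<Rightarrow> 'a \<Rightarrow> 'a" where
  "riem_hess M g x u = orth_proj (tangent_space M x) (mdiff M (riem_grad M g) x u)"

definition riem_second_order_stationary ::
  "'a::euclidean_space set \<Rightarrow> ('a \<Rightarrow> real) \<Rightarrow> 'a \<Rightarrow> bool" where
  "riem_second_order_stationary M g x \<longleftrightarrow>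
     x \<in> M \<and> riem_grad M g x = 0 \<and> (\<forall>u\<in>tangent_space M x. 0 \<le> u \<bullet> riem_hess M g x u)"

section \<open>The two parametrizations\<close>

text \<open>
  The sizes are \<open>n k = card (I k)\<close> and the ranks are \<open>r k = card (J k)\<close>. The inner product of the
  type of points is the sum of the Frobenius inner products of the components.
\<close>

type_synonym ('d, 'n) point = "(real^('d \<Rightarrow> 'n)) \<times> ((real^'n^'n)^'d)"

definition desing_manifold ::
  "('d::finite \<Rightarrow> 'n::finite set) \<Rightarrow> ('d \<Rightarrow> 'n set) \<Rightarrow> ('d, 'n) point set" where
  "desing_manifold I J = {(X, P). X \<in> tensors I \<and>
     (\<forall>k. P $ k \<in> Gr (card (I k) - card (J k)) (I k)) \<and>
     (\<forall>k. mode_prod X k (P $ k) = 0)}"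

definition desing_map :: "('d::finite, 'n::finite) point \<Rightarrow> real^('d \<Rightarrow> 'n)" where
  "desing_map = (\<lambda>(X, P). X)"

definition represented_point ::
  "('d::finite \<Rightarrow> 'n::finite set) \<Rightarrow> ('d, 'n) point \<Rightarrow> ('d, 'n) point" where
  "represented_point I = (\<lambda>(G, U).
     (multi_prod G U, \<chi> k. idm (I k) - U $ k ** transpose (U $ k)))"

definition tucker_space ::
  "('d::finite \<Rightarrow> 'n::finite set) \<Rightarrow> ('d \<Rightarrow> 'n set) \<Rightarrow> ('d, 'n) point set" where
  "tucker_space I J = {(G, U). G \<in> tensors J \<and> (\<forall>k. U $ k \<in> mats (I k) (J k))}"

definition tucker_map :: "('d::finite, 'n::finite) point \<Rightarrow> real^('d \<Rightarrow> 'n)" where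
  "tucker_map = (\<lambda>(G, U). multi_prod G U)"

text \<open>
  Such an \<open>R\<close> exists iff every factor matrix \<open>U k\<close> has full column rank. Points with deficient
  factors cannot be matched: for minus the squared norm as cost, the origin of the Tucker
  parametrization is second-order stationary, but no point of the desingularization is.
\<close>

definition orthonormalizes :: "('d::finite \<Rightarrow> 'n::finite set) \<Rightarrow> ('d \<Rightarrow> 'n set) \<Rightarrow>
    (real^'n^'n)^'d \<Rightarrow> (real^'n^'n)^'d \<Rightarrow> bool" where
  "orthonormalizes I J U R \<longleftrightarrow>
     (\<forall>k. R $ k \<in> GL (J k) \<and> U $ k ** R $ k \<in> St (J k) (I k))"

end

theory Submission
  imports Defs
begin

text \<open>
  A point \<open>p = (G, U)\<close> of the Tucker space with orthonormal frames represents a point \<open>x\<close> of the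
  manifold. A line \<open>p + t h\<close> in the Tucker space induces, for small \<open>t\<close>, a curve
  \<open>c\<close> through \<open>x\<close> on the manifold, whose second component projects onto the
  complement of the column spaces of the moving frames; the cost along the line and along the curve
  is the same function of \<open>t\<close>. Every tangent vector at \<open>x\<close> is the velocity of such a curve. Writing
  \<open>\<gamma>\<close> for the Euclidean gradient of the Tucker cost and \<open>w\<close> for the Riemannian gradient, this gives
  \<open>\<gamma> (p + t h) \<bullet> h = w (c t) \<bullet> c' t\<close>. At \<open>t = 0\<close> it shows that the gradients vanish together, and if
  they do, its derivative at \<open>t = 0\<close> identifies the two Hessian quadratic forms, the term with
  \<open>c''\<close> being multiplied by \<open>w x = 0\<close>. General full-rank frames reduce to orthonormal ones by the
  linear change of variables \<open>R\<close>, which preserves the Tucker cost. That \<open>w\<close> is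
  differentiable follows from an explicit formula: the projection onto the tangent space only needs
  the inverses of the positive definite matrices \<open>2 + X\<^sub>k X\<^sub>k\<^sup>T\<close>, where \<open>X\<^sub>k\<close> is an unfolding of the tensor.
\<close>

section \<open>Calculus of \<open>C\<^sup>m\<close> maps\<close>

text \<open>The Tucker space is redundant: changing frames moves \<open>p\<close> without moving
  \<open>x\<close>, so the map from directions \<open>h\<close> to velocities is onto but not
  injective. Stationarity therefore transfers through two one-sided statements, \<open>key\<close>
  for every \<open>h\<close> and \<open>lift\<close> for every tangent vector, rather than through
  an isomorphism of tangent spaces. The identity of first derivatives must hold for all small times
  before it can be differentiated, while frames along a line need not stay orthonormal; this forces
  a projection formula with an inverse Gram matrix. Its derivative is never computed: the velocity
  is pinned down by the linearized equations of the manifold and by two identities that hold along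
  the curve. The formula for \<open>w\<close> makes sense on the whole ambient space, so
  \<open>w\<close> has an ordinary derivative there and the chain rule along \<open>c\<close>
  applies. The constant 2 arises because the matrix part of a tangent vector is, up to sign, the sum
  of a block and its transpose, which are orthogonal and of equal norm.\<close>

lemma Ck_on_imp_continuous_on: "Ck_on m W S F \<Longrightarrow> continuous_on S F"
  by (cases m) (auto simp: continuous_on_eq_continuous_within intro: has_derivative_continuous)

lemma Ck_on_Suc_imp: "Ck_on (Suc m) W S F \<Longrightarrow> Ck_on m W S F"
proof (induction m arbitrary: F)
  case 0
  then show ?case using Ck_on_imp_continuous_on[OF 0] by simp
next
  case (Suc m)
  then show ?case by (metis Ck_on.simps(2))
qed

lemma Ck_on_cong:
  assumes "\<And>x. x \<in> S \<Longrightarrow> F x = G x" shows "Ck_on m W S F \<longleftrightarrow> Ck_on m W S G"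
proof (cases m)
  case 0
  then show ?thesis using assms by (simp cong: continuous_on_cong)
next
  case (Suc n)
  have "(F has_derivative D) (at x within S) \<longleftrightarrow> (G has_derivative D) (at x within S)"
    if "x \<in> S" for x D
    using that has_derivative_transform[OF that, of F G] has_derivative_transform[OF that, of G F] assms
    by auto
  then show ?thesis unfolding Suc by (simp cong: conj_cong)
qed

lemma Ck_on_const [intro, simp]: "Ck_on m W S (\<lambda>x. c)"
proof (induction m arbitrary: c)
  case (Suc m)
  have "\<forall>x\<in>S. ((\<lambda>x. c) has_derivative (\<lambda>h. 0)) (at x within S)" by simp
  with Suc[of 0] show ?case unfolding Ck_on.simps
    by (intro exI[of _ "\<lambda>x h. 0"]) simp
qed simp

lemma Ck_on_add: "Ck_on m W S F \<Longrightarrow> Ck_on m W S G \<Longrightarrow> Ck_on m W S (\<lambda>x. F x + G x)"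
proof (induction m arbitrary: F G)
  case (Suc m)
  from Suc.prems obtain F' G' where
    F: "\<forall>x\<in>S. (F has_derivative F' x) (at x within S)" "\<forall>h\<in>W. Ck_on m W S (\<lambda>x. F' x h)" and
    G: "\<forall>x\<in>S. (G has_derivative G' x) (at x within S)" "\<forall>h\<in>W. Ck_on m W S (\<lambda>x. G' x h)"
    unfolding Ck_on.simps by fast
  then have "\<forall>x\<in>S. ((\<lambda>x. F x + G x) has_derivative (\<lambda>h. F' x h + G' x h)) (at x within S)"
    by (auto intro: has_derivative_add)
  with Suc.IH F G show ?case unfolding Ck_on.simps
    by (intro exI[of _ "\<lambda>x h. F' x h + G' x h"]) simp
qed (simp add: continuous_on_add)

lemma Ck_on_bilinear:
  assumes "bounded_bilinear B"
  shows "Ck_on m W S F \<Longrightarrow> Ck_on m W S G \<Longrightarrow> Ck_on m W S (\<lambda>x. B (F x) (G x))"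
proof (induction m arbitrary: F G)
  case 0
  then show ?case by (simp add: bounded_bilinear.continuous_on[OF assms])
next
  case (Suc m)
  from Suc.prems obtain F' G' where
    F: "\<forall>x\<in>S. (F has_derivative F' x) (at x within S)" "\<forall>h\<in>W. Ck_on m W S (\<lambda>x. F' x h)" and
    G: "\<forall>x\<in>S. (G has_derivative G' x) (at x within S)" "\<forall>h\<in>W. Ck_on m W S (\<lambda>x. G' x h)"
    unfolding Ck_on.simps by fast
  then have "\<forall>x\<in>S. ((\<lambda>x. B (F x) (G x)) has_derivative (\<lambda>h. B (F x) (G' x h) + B (F' x h) (G x)))
      (at x within S)"
    by (auto intro: bounded_bilinear.FDERIV[OF assms])
  moreover have "Ck_on m W S F" "Ck_on m W S G"
    using Suc.prems[THEN Ck_on_Suc_imp] by auto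
  ultimately show ?case using Suc.IH F G unfolding Ck_on.simps
    by (intro exI[of _ "\<lambda>x h. B (F x) (G' x h) + B (F' x h) (G x)"]) (auto intro!: Ck_on_add)
qed

lemma Ck_on_linear:
  assumes "bounded_linear L" shows "Ck_on m W S F \<Longrightarrow> Ck_on m W S (\<lambda>x. L (F x))"
proof (induction m arbitrary: F)
  case 0
  then show ?case by (simp add: bounded_linear.continuous_on[OF assms])
next
  case (Suc m)
  from Suc.prems obtain F' where
    F: "\<forall>x\<in>S. (F has_derivative F' x) (at x within S)" "\<forall>h\<in>W. Ck_on m W S (\<lambda>x. F' x h)"
    unfolding Ck_on.simps by fast
  then have "\<forall>x\<in>S. ((\<lambda>x. L (F x)) has_derivative (\<lambda>h. L (F' x h))) (at x within S)"
    by (auto intro: bounded_linear.has_derivative[OF assms])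
  with Suc.IH F show ?case unfolding Ck_on.simps by (intro exI[of _ "\<lambda>x h. L (F' x h)"]) simp
qed

lemma Ck_on_id [intro, simp]: "Ck_on m W S (\<lambda>x. x)"
proof (cases m)
  case (Suc n)
  have "\<forall>x\<in>S. ((\<lambda>x. x) has_derivative (\<lambda>h. h)) (at x within S)" by simp
  then show ?thesis unfolding Suc Ck_on.simps by fastforce
qed (simp add: continuous_on_id)

lemma Ck_on_minus: "Ck_on m W S F \<Longrightarrow> Ck_on m W S (\<lambda>x. - F x)"
  by (rule Ck_on_linear[OF bounded_linear_minus[OF bounded_linear_ident]])

lemma Ck_on_diff: "Ck_on m W S F \<Longrightarrow> Ck_on m W S G \<Longrightarrow> Ck_on m W S (\<lambda>x. F x - G x)"
  using Ck_on_add[of m W S F "\<lambda>x. - G x"] Ck_on_minus[of m W S G] by simp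

lemma Ck_on_sum:
  "(\<And>i. i \<in> A \<Longrightarrow> Ck_on m W S (F i)) \<Longrightarrow> Ck_on m W S (\<lambda>x. \<Sum>i\<in>A. F i x)"
  by (induction A rule: infinite_finite_induct) (auto intro: Ck_on_add)

lemma Ck_on_mult:
  fixes F G :: "'a::real_normed_vector \<Rightarrow> 'b::real_normed_algebra"
  shows "Ck_on m W S F \<Longrightarrow> Ck_on m W S G \<Longrightarrow> Ck_on m W S (\<lambda>x. F x * G x)"
  by (rule Ck_on_bilinear[OF bounded_bilinear_mult])

lemma Ck_on_prod:
  fixes F :: "'i \<Rightarrow> 'a::real_normed_vector \<Rightarrow> 'b::real_normed_field"
  shows "(\<And>i. i \<in> A \<Longrightarrow> Ck_on m W S (F i)) \<Longrightarrow> Ck_on m W S (\<lambda>x. \<Prod>i\<in>A. F i x)"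
  by (induction A rule: infinite_finite_induct) (auto intro: Ck_on_mult)

text \<open>The derivative of the inverse is a product of the inverse itself, taken at the lower
  order, and of \<open>F'\<close>, so the induction on the order closes.\<close>

lemma Ck_on_inverse:
  fixes F :: "'a::real_normed_vector \<Rightarrow> 'b::real_normed_field"
  shows "Ck_on m W S F \<Longrightarrow> (\<And>x. x \<in> S \<Longrightarrow> F x \<noteq> 0) \<Longrightarrow> Ck_on m W S (\<lambda>x. inverse (F x))"
proof (induction m arbitrary: F)
  case 0
  then show ?case by (simp add: continuous_on_inverse)
next
  case (Suc m)
  from Suc.prems obtain F' where
    F: "\<forall>x\<in>S. (F has_derivative F' x) (at x within S)" "\<forall>h\<in>W. Ck_on m W S (\<lambda>x. F' x h)"
    unfolding Ck_on.simps by fast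
  have "\<forall>x\<in>S. ((\<lambda>x. inverse (F x)) has_derivative (\<lambda>h. - (inverse (F x) * F' x h * inverse (F x))))
      (at x within S)"
    using F Suc.prems by (auto intro: has_derivative_inverse)
  moreover have "Ck_on m W S (\<lambda>x. inverse (F x))"
    by (rule Suc.IH[OF Ck_on_Suc_imp[OF Suc.prems(1)] Suc.prems(2)])
  ultimately show ?case using F unfolding Ck_on.simps
    by (intro exI[of _ "\<lambda>x h. - (inverse (F x) * F' x h * inverse (F x))"])
       (auto intro!: Ck_on_minus Ck_on_mult)
qed

lemma Ck_on_componentwise:
  fixes F :: "'a::real_normed_vector \<Rightarrow> 'b::euclidean_space"
  assumes "\<And>b. b \<in> Basis \<Longrightarrow> Ck_on m W S (\<lambda>x. F x \<bullet> b)"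
  shows "Ck_on m W S F"
proof -
  have "Ck_on m W S (\<lambda>x. \<Sum>b\<in>Basis. (F x \<bullet> b) *\<^sub>R b)"
    using assms by (intro Ck_on_sum Ck_on_bilinear[OF bounded_bilinear_scaleR]) auto
  then show ?thesis by (simp add: euclidean_representation)
qed

lemma Ck_on_vec_lambda:
  fixes F :: "'i::finite \<Rightarrow> 'a::real_normed_vector \<Rightarrow> 'b::euclidean_space"
  assumes "\<And>i. Ck_on m W S (F i)"
  shows "Ck_on m W S (\<lambda>x. \<chi> i. F i x)"
proof (rule Ck_on_componentwise)
  fix b :: "'b^'i" assume "b \<in> Basis"
  then obtain i e where "b = axis i e" by (auto simp: Basis_vec_def)
  then show "Ck_on m W S (\<lambda>x. (\<chi> i. F i x) \<bullet> b)"
    using Ck_on_linear[OF bounded_linear_inner_left assms[of i]] by (simp add: inner_axis)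
qed

lemma Ck_on_Pair:
  fixes F :: "'a::real_normed_vector \<Rightarrow> 'b::real_normed_vector" and G :: "'a \<Rightarrow> 'd::real_normed_vector"
  assumes "Ck_on m W S F" "Ck_on m W S G"
  shows "Ck_on m W S (\<lambda>x. (F x, G x))"
proof -
  have "bounded_linear (\<lambda>x::'b. (x, 0::'d))" "bounded_linear (\<lambda>x::'d. (0::'b, x))"
    by (auto intro!: bounded_linear_Pair bounded_linear_ident bounded_linear_zero)
  from Ck_on_add[OF Ck_on_linear[OF this(1) assms(1)] Ck_on_linear[OF this(2) assms(2)]]
  show ?thesis by simp
qed

lemma Ck_on_compose:
  fixes F :: "'b::euclidean_space \<Rightarrow> 'c::real_normed_vector"
  shows "Ck_on m UNIV UNIV F \<Longrightarrow> Ck_on m W S G \<Longrightarrow> Ck_on m W S (\<lambda>x. F (G x))"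
proof (induction m arbitrary: F)
  case 0
  then show ?case by (auto intro: continuous_on_compose2)
next
  case (Suc m)
  from Suc.prems obtain F' G' where
    F: "\<forall>x. (F has_derivative F' x) (at x)" "\<forall>h. Ck_on m UNIV UNIV (\<lambda>x. F' x h)" and
    G: "\<forall>x\<in>S. (G has_derivative G' x) (at x within S)" "\<forall>h\<in>W. Ck_on m W S (\<lambda>x. G' x h)"
    unfolding Ck_on.simps by auto
  have "\<forall>x\<in>S. ((\<lambda>x. F (G x)) has_derivative (\<lambda>h. F' (G x) (G' x h))) (at x within S)"
    using F(1) G(1) has_derivative_compose by blast
  moreover have "Ck_on m W S (\<lambda>x. F' (G x) (G' x h))" if "h \<in> W" for h
  proof -
    \<comment> \<open>\<open>Ck_on\<close> controls \<open>F' y k\<close> only for a fixed direction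
      \<open>k\<close>, whereas the direction \<open>G' x h\<close> moves with \<open>x\<close>.
      Expanding in the basis leaves fixed directions with scalar coefficients.\<close>
    have *: "F' y k = (\<Sum>b\<in>Basis. (k \<bullet> b) *\<^sub>R F' y b)" for y k
    proof -
      have L: "linear (F' y)" using F(1) has_derivative_linear by blast
      have "F' y k = F' y (\<Sum>b\<in>Basis. (k \<bullet> b) *\<^sub>R b)" by (simp add: euclidean_representation)
      then show ?thesis by (simp add: linear_sum[OF L] linear_cmul[OF L])
    qed
    have G0: "Ck_on m W S G" using Suc.prems(2) by (rule Ck_on_Suc_imp)
    have "Ck_on m W S (\<lambda>x. (G' x h \<bullet> b) *\<^sub>R F' (G x) b)" for b
      using Suc.IH[OF F(2)[rule_format, of b] G0] G(2) that
      by (intro Ck_on_bilinear[OF bounded_bilinear_scaleR] Ck_on_linear[OF bounded_linear_inner_left])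
        auto
    then show ?thesis by (subst *) (rule Ck_on_sum)
  qed
  ultimately show ?case unfolding Ck_on.simps
    by (intro exI[of _ "\<lambda>x h. F' (G x) (G' x h)"]) auto
qed

section \<open>Matrix algebra and smoothness of the matrix inverse\<close>

lemma matrix_add_rdistrib:
  fixes A B :: "real^'n::finite^'m::finite" and C :: "real^'p::finite^'n"
  shows "(A + B) ** C = A ** C + B ** C"
  by (simp add: matrix_matrix_mult_def vec_eq_iff distrib_right sum.distrib)

lemma matrix_scaleR_left:
  fixes A :: "real^'n::finite^'m::finite" and B :: "real^'p::finite^'n"
  shows "(c *\<^sub>R A) ** B = c *\<^sub>R (A ** B)"
  by (simp add: matrix_matrix_mult_def vec_eq_iff sum_distrib_left mult.assoc)

lemma matrix_scaleR_right:
  fixes A :: "real^'n::finite^'m::finite" and B :: "real^'p::finite^'n"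
  shows "A ** (c *\<^sub>R B) = c *\<^sub>R (A ** B)"
  by (simp add: matrix_matrix_mult_def vec_eq_iff sum_distrib_left mult.left_commute)

lemma matrix_minus_left:
  fixes A :: "real^'n::finite^'m::finite" and B :: "real^'p::finite^'n"
  shows "(- A) ** B = - (A ** B)"
  using matrix_scaleR_left[of "-1" A B] by simp

lemma matrix_minus_right:
  fixes A :: "real^'n::finite^'m::finite" and B :: "real^'p::finite^'n"
  shows "A ** (- B) = - (A ** B)"
  using matrix_scaleR_right[of A "-1" B] by simp

lemma matrix_diff_ldistrib:
  fixes A :: "real^'n::finite^'m::finite" and B C :: "real^'p::finite^'n"
  shows "A ** (B - C) = A ** B - A ** C"
  using matrix_add_ldistrib[of A B "- C"] by (simp add: matrix_minus_right)

lemma matrix_diff_rdistrib: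
  fixes A B :: "real^'n::finite^'m::finite" and C :: "real^'p::finite^'n"
  shows "(A - B) ** C = A ** C - B ** C"
  using matrix_add_rdistrib[of A "- B" C] by (simp add: matrix_minus_left)

lemma transpose_add: "transpose (A + B) = transpose A + transpose B"
  by (simp add: transpose_def vec_eq_iff)

lemma transpose_diff: "transpose (A - B) = transpose A - transpose B"
  by (simp add: transpose_def vec_eq_iff)

lemma transpose_minus: "transpose (- A) = - transpose A"
  by (simp add: transpose_def vec_eq_iff)

lemma matrix_inv_inverse:
  fixes A :: "real^'n::finite^'n"
  assumes "det A \<noteq> 0" shows "A ** matrix_inv A = mat 1" "matrix_inv A ** A = mat 1"
proof -
  have "\<exists>B. A ** B = mat 1 \<and> B ** A = mat 1"
    using assms invertible_det_nz[of A] unfolding invertible_def by blast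
  then have "A ** matrix_inv A = mat 1 \<and> matrix_inv A ** A = mat 1"
    unfolding matrix_inv_def by (rule someI_ex)
  then show "A ** matrix_inv A = mat 1" "matrix_inv A ** A = mat 1" by auto
qed

lemma bounded_bilinear_matrix_matrix_mult:
  "bounded_bilinear ((**) :: real^'n::finite^'m::finite \<Rightarrow> real^'p::finite^'n \<Rightarrow> real^'p^'m)"
  unfolding bilinear_conv_bounded_bilinear[symmetric] bilinear_def
  by (auto intro!: linearI simp: matrix_add_ldistrib matrix_add_rdistrib matrix_scaleR_left matrix_scaleR_right)

lemma Ck_on_matrix_mult:
  fixes F :: "'a::real_normed_vector \<Rightarrow> real^'n::finite^'m::finite" and G :: "'a \<Rightarrow> real^'p::finite^'n"
  shows "Ck_on m W S F \<Longrightarrow> Ck_on m W S G \<Longrightarrow> Ck_on m W S (\<lambda>x. F x ** G x)"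
  using Ck_on_bilinear[OF bounded_bilinear_matrix_matrix_mult, of m W S F G] by blast

lemma bounded_linear_transpose:
  "bounded_linear (transpose :: real^'n::finite^'m::finite \<Rightarrow> real^'m^'n)"
  by (intro linear_conv_bounded_linear[THEN iffD1] linearI) (auto simp: transpose_def vec_eq_iff)

lemma Ck_on_vec_nth: 
  fixes F :: "'a::real_normed_vector \<Rightarrow> 'b::euclidean_space^'n::finite"
  shows "Ck_on m W S F \<Longrightarrow> Ck_on m W S (\<lambda>x. F x $ i)"
  by (rule Ck_on_linear[OF bounded_linear_vec_nth])

lemma Ck_on_det:
  fixes F :: "'a::real_normed_vector \<Rightarrow> real^'n::finite^'n"
  assumes "Ck_on m W S F" shows "Ck_on m W S (\<lambda>x. det (F x))"
  unfolding det_def by (intro Ck_on_sum Ck_on_mult Ck_on_prod Ck_on_const Ck_on_vec_nth assms)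

text \<open>Cramer's rule applied to each column of the inverse. It writes the entries as
  polynomials divided by the determinant, which reduces smoothness of the inverse to sums, products
  and a scalar inverse.\<close>

lemma matrix_inv_cramer:
  fixes A :: "real^'n::finite^'n"
  assumes "det A \<noteq> 0"
  shows "matrix_inv A =
    (\<chi> i j. inverse (det A) * det (\<chi> k l. if l = i then axis j 1 $ k else A $ k $ l))"
proof -
  have "A *v column j (matrix_inv A) = axis j 1" for j
  proof -
    have "A *v column j (matrix_inv A) = (A ** matrix_inv A) *v axis j 1"
      by (simp add: matrix_vector_mult_basis[symmetric] matrix_vector_mul_assoc)
    then show ?thesis using assms by (simp add: matrix_inv_inverse)
  qed
  then have "column j (matrix_inv A) = (\<chi> i. det (\<chi> k l. if l = i then axis j 1 $ k else A $ k $ l) / det A)" for j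
    using cramer[OF assms] by blast
  then show ?thesis by (simp add: vec_eq_iff column_def field_simps)
qed

lemma Ck_on_matrix_inv:
  fixes F :: "'a::real_normed_vector \<Rightarrow> real^'n::finite^'n"
  assumes "Ck_on m W S F" "\<And>x. x \<in> S \<Longrightarrow> det (F x) \<noteq> 0"
  shows "Ck_on m W S (\<lambda>x. matrix_inv (F x))"
proof -
  have "Ck_on m W S (\<lambda>x. if b then c else F x $ k $ l)" for b c k l
    by (cases b) (auto intro!: Ck_on_vec_nth assms)
  then have "Ck_on m W S (\<lambda>x. \<chi> i j. inverse (det (F x)) *
      det (\<chi> k l. if l = i then axis j 1 $ k else F x $ k $ l))"
    using assms by (intro Ck_on_vec_lambda Ck_on_mult Ck_on_inverse Ck_on_det)
  then show ?thesis
    using assms(2) by (subst Ck_on_cong[where G = "\<lambda>x. \<chi> i j. inverse (det (F x)) *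
      det (\<chi> k l. if l = i then axis j 1 $ k else F x $ k $ l)"]) (auto simp: matrix_inv_cramer)
qed

lemma Ck_on_gradient:
  fixes F :: "'a::euclidean_space \<Rightarrow> real"
  assumes "Ck_on (Suc m) UNIV UNIV F"
  obtains G where "\<And>x. (F has_derivative (\<lambda>h. G x \<bullet> h)) (at x)" "Ck_on m UNIV UNIV G"
proof -
  obtain F' where F: "\<And>x. (F has_derivative F' x) (at x)" "\<And>h. Ck_on m UNIV UNIV (\<lambda>x. F' x h)"
    using assms unfolding Ck_on.simps by auto
  define G where "G x = (\<Sum>b\<in>Basis. F' x b *\<^sub>R b)" for x
  have "F' x = (\<lambda>h. G x \<bullet> h)" for x
  proof
    fix h
    have L: "linear (F' x)" using F(1) has_derivative_linear by blast
    have "F' x h = F' x (\<Sum>b\<in>Basis. (h \<bullet> b) *\<^sub>R b)" by (simp add: euclidean_representation)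
    then show "F' x h = G x \<bullet> h"
      by (simp add: linear_sum[OF L] linear_cmul[OF L] G_def inner_sum_right inner_commute[of _ h] mult.commute)
  qed
  moreover have "Ck_on m UNIV UNIV G"
    unfolding G_def by (intro Ck_on_sum Ck_on_bilinear[OF bounded_bilinear_scaleR] F Ck_on_const)
  ultimately show ?thesis using that F(1) by metis
qed

text \<open>Here the outer map is differentiable only within \<open>W\<close>, so
  \<open>Ck_on_compose\<close> does not apply. The induction works because every direction
  \<open>L h\<close> lies in \<open>W\<close>, where the derivative is known to be of lower class.
  With \<open>L\<close> a projection onto \<open>W\<close>, it extends a map from \<open>W\<close>
  to the whole space.\<close>

lemma Ck_on_compose_projection:
  assumes "bounded_linear L" "range L \<subseteq> W"
  shows "Ck_on m W W F \<Longrightarrow> Ck_on m UNIV UNIV (\<lambda>x. F (L x))"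
proof (induction m arbitrary: F)
  case 0
  then show ?case
    using assms by (auto intro!: continuous_on_compose2[of W F _ L] linear_continuous_on[of L])
next
  case (Suc m)
  from Suc.prems obtain F' where
    F: "\<forall>x\<in>W. (F has_derivative F' x) (at x within W)" "\<forall>h\<in>W. Ck_on m W W (\<lambda>x. F' x h)"
    unfolding Ck_on.simps by auto
  have "((\<lambda>x. F (L x)) has_derivative (\<lambda>h. F' (L x) (L h))) (at x)" for x
  proof (rule has_derivative_in_compose2[of W F])
    show "\<And>x. x \<in> W \<Longrightarrow> (F has_derivative F' x) (at x within W)" using F by blast
    show "L ` UNIV \<subseteq> W" using assms by auto
    show "(L has_derivative L) (at x within UNIV)" 
      using assms(1) bounded_linear_imp_has_derivative by blast
  qed simp
  moreover have "Ck_on m UNIV UNIV (\<lambda>x. F' (L x) (L h))" for h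
    using F assms(2) by (intro Suc.IH[of "\<lambda>x. F' x (L h)"]) (simp add: range_subsetD)
  ultimately show ?case unfolding Ck_on.simps
    by (intro exI[of _ "\<lambda>x h. F' (L x) (L h)"]) auto
qed

section \<open>Zero-padded matrices and tensors\<close>

lemma idm_mult_component: "(idm A ** M) $ i $ j = (if i \<in> A then M $ i $ j else 0)"
proof -
  have "(idm A ** M) $ i $ j = (\<Sum>k\<in>UNIV. if k = i then (if i \<in> A then M $ i $ j else 0) else 0)"
    unfolding matrix_matrix_mult_def vec_lambda_beta by (rule sum.cong) (auto simp: idm_def)
  then show ?thesis by simp
qed

lemma mult_idm_component: "(M ** idm A) $ i $ j = (if j \<in> A then M $ i $ j else 0)"
proof -
  have "(M ** idm A) $ i $ j = (\<Sum>k\<in>UNIV. if k = j then (if j \<in> A then M $ i $ j else 0) else 0)"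
    unfolding matrix_matrix_mult_def vec_lambda_beta by (rule sum.cong) (auto simp: idm_def)
  then show ?thesis by simp
qed

text \<open>Turning the support condition into equations lets closure properties follow by matrix
  algebra and lets the condition be differentiated along curves. \<open>tensors_iff\<close> does the
  same for tensors.\<close>

lemma mats_iff: "M \<in> mats A B \<longleftrightarrow> idm A ** M = M \<and> M ** idm B = M"
  unfolding mats_def vec_eq_iff idm_mult_component mult_idm_component by auto

lemma idm_mult: "M \<in> mats A B \<Longrightarrow> idm A ** M = M"
  and mult_idm: "M \<in> mats A B \<Longrightarrow> M ** idm B = M"
  by (simp_all add: mats_iff)

lemma idm_mats [simp]: "idm A \<in> mats A A"
  by (auto simp: mats_def idm_def)

lemma idm_idem [simp]: "idm A ** idm A = idm A"
  by (rule idm_mult[of _ A A]) simp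

lemma transpose_idm [simp]: "transpose (idm A) = idm A"
  by (auto simp: transpose_def idm_def vec_eq_iff)

lemma mats_mult: "M \<in> mats A B \<Longrightarrow> N \<in> mats B C \<Longrightarrow> M ** N \<in> mats A C"
  unfolding mats_iff by (metis matrix_mul_assoc)

lemma mats_mult3: "idm A ** M = M \<Longrightarrow> N ** idm B = N \<Longrightarrow> M ** K ** N \<in> mats A B"
  unfolding mats_iff by (metis matrix_mul_assoc)

lemma transpose_mats: "M \<in> mats A B \<Longrightarrow> transpose M \<in> mats B A"
  by (auto simp: mats_def transpose_def)

lemma subspace_mats: "subspace (mats A B)"
  unfolding subspace_def
  by (simp add: mats_iff matrix_add_ldistrib matrix_add_rdistrib matrix_scaleR_left matrix_scaleR_right) 

lemmas mats_add = subspace_add[OF subspace_mats]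
  and mats_diff = subspace_diff[OF subspace_mats]
  and mats_neg = subspace_neg[OF subspace_mats]
  and mats_scaleR = subspace_mul[OF subspace_mats]
  and mats_0 = subspace_0[OF subspace_mats]

section \<open>Mode products, their adjoints and mode Gram matrices\<close>

lemma bilinear_mode_prod: "bounded_bilinear (\<lambda>X A. mode_prod X k A)"
  unfolding bilinear_conv_bounded_bilinear[symmetric] bilinear_def
  by (auto intro!: linearI simp: mode_prod_def vec_eq_iff sum.distrib distrib_left distrib_right
      sum_distrib_left mult_ac)

lemmas mode_prod_add_left = bounded_bilinear.add_left[OF bilinear_mode_prod]
  and mode_prod_add_right = bounded_bilinear.add_right[OF bilinear_mode_prod]
  and mode_prod_diff_left = bounded_bilinear.diff_left[OF bilinear_mode_prod]
  and mode_prod_diff_right = bounded_bilinear.diff_right[OF bilinear_mode_prod]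
  and mode_prod_minus_left = bounded_bilinear.minus_left[OF bilinear_mode_prod]
  and mode_prod_minus_right = bounded_bilinear.minus_right[OF bilinear_mode_prod]
  and mode_prod_scaleR_left = bounded_bilinear.scaleR_left[OF bilinear_mode_prod]
  and mode_prod_scaleR_right = bounded_bilinear.scaleR_right[OF bilinear_mode_prod]
  and mode_prod_zero_left = bounded_bilinear.zero_left[OF bilinear_mode_prod]
  and mode_prod_zero_right = bounded_bilinear.zero_right[OF bilinear_mode_prod]
  and mode_prod_sum_left = bounded_bilinear.sum_left[OF bilinear_mode_prod]

lemma mode_prod_mode_prod: "mode_prod (mode_prod X k A) k B = mode_prod X k (B ** A)"
proof -
  have "(\<Sum>i\<in>UNIV. B $ j k $ i * (\<Sum>l\<in>UNIV. A $ i $ l * X $ (j(k := l)))) =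
      (\<Sum>i\<in>UNIV. (\<Sum>l\<in>UNIV. B $ j k $ l * A $ l $ i) * X $ (j(k := i)))" for j
    unfolding sum_distrib_left sum_distrib_right by (subst sum.swap) (simp add: mult.assoc)
  then show ?thesis by (simp add: mode_prod_def vec_eq_iff matrix_matrix_mult_def)
qed

lemma mode_prod_idm_component: "mode_prod X k (idm A) $ j = (if j k \<in> A then X $ j else 0)"
proof -
  have "mode_prod X k (idm A) $ j = (\<Sum>i\<in>UNIV. if i = j k then (if j k \<in> A then X $ j else 0) else 0)"
    unfolding mode_prod_def vec_lambda_beta by (rule sum.cong) (auto simp: idm_def)
  then show ?thesis by simp
qed

lemma tensors_iff: "X \<in> tensors I \<longleftrightarrow> (\<forall>k. mode_prod X k (idm (I k)) = X)"
  unfolding tensors_def vec_eq_iff mode_prod_idm_component by auto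

lemma subspace_tensors: "subspace (tensors I)"
  unfolding subspace_def
  by (simp add: tensors_iff mode_prod_add_left mode_prod_scaleR_left mode_prod_zero_left) 

text \<open>Swapping \<open>i\<close> and \<open>j k\<close> is an involution of the pairs \<open>(j, i)\<close>.\<close>

lemma sum_mode_swap:
  fixes F :: "('d::finite \<Rightarrow> 'n::finite) \<Rightarrow> 'n \<Rightarrow> real"
  shows "(\<Sum>j\<in>UNIV. \<Sum>i\<in>UNIV. F j i) = (\<Sum>j\<in>UNIV. \<Sum>i\<in>UNIV. F (j(k := i)) (j k))"
proof -
  have "(\<Sum>p\<in>UNIV. case p of (j, i) \<Rightarrow> F j i) = (\<Sum>p\<in>UNIV. case p of (j, i) \<Rightarrow> F (j(k := i)) (j k))"
    by (rule sum.reindex_bij_witness[of _ "\<lambda>(j, i). (j(k := i), j k)" "\<lambda>(j, i). (j(k := i), j k)"]) auto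
  then show ?thesis by (simp add: sum.cartesian_product UNIV_Times_UNIV[symmetric] del: UNIV_Times_UNIV)
qed

text \<open>This is the mode-\<open>k\<close> unfolding of \<open>X\<close> times the transposed
  unfolding of \<open>Y\<close>. Summing over full multi-indices with entry \<open>i\<close> at
  \<open>k\<close> avoids a separate index type for the remaining modes.\<close>

definition mode_gram ::
  "'d \<Rightarrow> real^('d::finite \<Rightarrow> 'n::finite) \<Rightarrow> real^('d \<Rightarrow> 'n) \<Rightarrow> real^'n^'n" where
  "mode_gram k X Y = (\<chi> i j. \<Sum>l\<in>UNIV. if l k = i then X $ l * Y $ (l(k := j)) else 0)"

text \<open>Hence \<open>mode_gram\<close> is the adjoint of the mode product in its matrix
  argument. The rules for \<open>mode_gram\<close> of a mode product follow by testing against an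
  arbitrary matrix.\<close>

lemma inner_mode_prod: "X \<bullet> mode_prod Y k A = mode_gram k X Y \<bullet> A"
proof -
  have "mode_gram k X Y \<bullet> A =
      (\<Sum>i\<in>UNIV. \<Sum>j\<in>UNIV. \<Sum>l\<in>UNIV. if l k = i then X $ l * Y $ (l(k := j)) * A $ i $ j else 0)"
    unfolding inner_vec_def mode_gram_def by (auto simp: sum_distrib_right intro!: sum.cong)
  also have "\<dots> = (\<Sum>j\<in>UNIV. \<Sum>i\<in>UNIV. \<Sum>l\<in>UNIV. if l k = i then X $ l * Y $ (l(k := j)) * A $ i $ j else 0)"
    by (rule sum.swap)
  also have "\<dots> = (\<Sum>j\<in>UNIV. \<Sum>l\<in>UNIV. \<Sum>i\<in>UNIV. if l k = i then X $ l * Y $ (l(k := j)) * A $ i $ j else 0)"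
    by (intro sum.cong refl sum.swap)
  also have "\<dots> = (\<Sum>j\<in>UNIV. \<Sum>l\<in>UNIV. X $ l * Y $ (l(k := j)) * A $ l k $ j)" by simp
  also have "\<dots> = (\<Sum>l\<in>UNIV. \<Sum>j\<in>UNIV. X $ l * Y $ (l(k := j)) * A $ l k $ j)" by (rule sum.swap)
  also have "\<dots> = X \<bullet> mode_prod Y k A"
    unfolding inner_vec_def mode_prod_def by (auto simp: sum_distrib_left mult_ac intro!: sum.cong)
  finally show ?thesis ..
qed

lemma mode_prod_adjoint: "mode_prod X k A \<bullet> Y = X \<bullet> mode_prod Y k (transpose A)"
proof -
  have "mode_prod X k A \<bullet> Y = (\<Sum>j\<in>UNIV. \<Sum>i\<in>UNIV. A $ j k $ i * X $ (j(k := i)) * Y $ j)"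
    unfolding inner_vec_def mode_prod_def by (auto simp: sum_distrib_right intro!: sum.cong)
  also have "\<dots> = (\<Sum>j\<in>UNIV. \<Sum>i\<in>UNIV. A $ i $ j k * X $ j * Y $ (j(k := i)))"
    by (subst sum_mode_swap[of _ k]) simp
  also have "\<dots> = X \<bullet> mode_prod Y k (transpose A)"
    unfolding inner_vec_def mode_prod_def transpose_def by (auto simp: sum_distrib_left mult_ac intro!: sum.cong)
  finally show ?thesis .
qed

lemma matrix_inner_mult_left: 
  fixes A B C :: "real^'n::finite^'n" shows "(A ** B) \<bullet> C = B \<bullet> (transpose A ** C)"
proof -
  have "(A ** B) \<bullet> C = (\<Sum>i\<in>UNIV. \<Sum>j\<in>UNIV. \<Sum>k\<in>UNIV. A $ i $ k * B $ k $ j * C $ i $ j)"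
    unfolding inner_vec_def matrix_matrix_mult_def by (auto simp: sum_distrib_right intro!: sum.cong)
  also have "\<dots> = (\<Sum>i\<in>UNIV. \<Sum>k\<in>UNIV. \<Sum>j\<in>UNIV. A $ i $ k * B $ k $ j * C $ i $ j)"
    by (intro sum.cong refl sum.swap)
  also have "\<dots> = (\<Sum>k\<in>UNIV. \<Sum>i\<in>UNIV. \<Sum>j\<in>UNIV. A $ i $ k * B $ k $ j * C $ i $ j)" by (rule sum.swap)
  also have "\<dots> = (\<Sum>k\<in>UNIV. \<Sum>j\<in>UNIV. \<Sum>i\<in>UNIV. A $ i $ k * B $ k $ j * C $ i $ j)"
    by (intro sum.cong refl sum.swap)
  also have "\<dots> = B \<bullet> (transpose A ** C)"
    unfolding inner_vec_def matrix_matrix_mult_def transpose_def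
    by (auto simp: sum_distrib_left mult_ac intro!: sum.cong)
  finally show ?thesis .
qed

lemma inner_transpose: "transpose A \<bullet> transpose B = A \<bullet> (B :: real^'n::finite^'m::finite)"
  unfolding inner_vec_def transpose_def by (simp, rule sum.swap)

lemma matrix_inner_mult_right: 
  fixes A B C :: "real^'n::finite^'n" shows "(A ** B) \<bullet> C = A \<bullet> (C ** transpose B)"
proof -
  have "(A ** B) \<bullet> C = (transpose B ** transpose A) \<bullet> transpose C"
    by (simp add: inner_transpose matrix_transpose_mul[symmetric])
  also have "\<dots> = transpose A \<bullet> transpose (C ** transpose B)"
    by (simp add: matrix_inner_mult_left matrix_transpose_mul)
  finally show ?thesis by (simp add: inner_transpose)
qed

lemma mode_gram_mode_prod_left: "mode_gram k (mode_prod X k A) Y = A ** mode_gram k X Y"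
proof (rule vector_eq_ldot[THEN iffD1, rule_format])
  fix B show "B \<bullet> mode_gram k (mode_prod X k A) Y = B \<bullet> (A ** mode_gram k X Y)"
    by (simp add: inner_commute[of B] inner_mode_prod[symmetric] mode_prod_adjoint
        matrix_inner_mult_left mode_prod_mode_prod)
qed

lemma mode_gram_mode_prod_right: "mode_gram k X (mode_prod Y k A) = mode_gram k X Y ** transpose A"
proof (rule vector_eq_ldot[THEN iffD1, rule_format])
  fix B show "B \<bullet> mode_gram k X (mode_prod Y k A) = B \<bullet> (mode_gram k X Y ** transpose A)"
    by (simp add: inner_commute[of B] inner_mode_prod[symmetric] mode_prod_mode_prod
        matrix_inner_mult_right)
qed

lemma bilinear_mode_gram: "bounded_bilinear (mode_gram k)"
  unfolding bilinear_conv_bounded_bilinear[symmetric] bilinear_def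
  by (auto intro!: linearI sum.cong
      simp: mode_gram_def vec_eq_iff distrib_left distrib_right sum_distrib_left sum.distrib[symmetric])

lemma mode_gram_psd: "0 \<le> v \<bullet> (mode_gram k X X *v v)"
proof -
  \<comment> \<open>With all rows equal to \<open>v\<close>, the mode product repeats the
    contraction of \<open>X\<close> with \<open>v\<close> along mode \<open>k\<close>. Its squared
    norm is thus \<open>CARD('a)\<close> times the quadratic form.\<close>
  define T :: "real^'a^'a" where "T = (\<chi> i. v)"
  have "0 \<le> mode_prod X k T \<bullet> mode_prod X k T" by simp
  also have "\<dots> = (T ** mode_gram k X X) \<bullet> T"
    by (simp add: inner_mode_prod mode_gram_mode_prod_left)
  also have "\<dots> = (\<Sum>i\<in>(UNIV::'a set). (v v* mode_gram k X X) \<bullet> v)"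
    unfolding inner_vec_def[of "T ** _"]
    by (intro sum.cong refl) (simp add: T_def matrix_matrix_mult_def vector_matrix_mult_def inner_vec_def mult.commute)
  also have "\<dots> = CARD('a) * (v \<bullet> (mode_gram k X X *v v))"
    by (simp add: dot_lmul_matrix)
  finally show ?thesis by (simp add: zero_le_mult_iff)
qed

text \<open>Twice the identity plus a positive semidefinite matrix has trivial kernel. No condition
  on \<open>X\<close> is required, which is what makes the gradient formula smooth on the whole
  ambient space.\<close>

lemma det_mode_gram: "det (mat 2 + mode_gram k X X) \<noteq> 0"
proof -
  have "v = 0" if "(mat 2 + mode_gram k X X) *v v = 0" for v
  proof -
    have "mat 2 *v v = 2 *\<^sub>R v"
      by (simp add: vec_eq_iff mat_def matrix_vector_mult_def if_distrib[of "\<lambda>x. x * _"] cong: if_cong)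
    then have "0 = v \<bullet> (2 *\<^sub>R v) + v \<bullet> (mode_gram k X X *v v)"
      using that by (metis inner_add_right inner_zero_right matrix_vector_mult_add_rdistrib)
    then have "v \<bullet> v \<le> 0" using mode_gram_psd[of v k X] by simp
    then show ?thesis by (metis inner_ge_zero inner_eq_zero_iff order_antisym)
  qed
  then show ?thesis
    by (metis invertible_det_nz invertible_left_inverse matrix_left_invertible_ker)
qed

text \<open>Folding over an arbitrary set of modes permits induction on that set, and taking
  \<open>UNIV - {k}\<close> isolates one mode.\<close>

definition modes_prod where
  "modes_prod S X A = Finite_Set.fold (\<lambda>k Y. mode_prod Y k (A $ k)) X S"

lemma modes_prod_UNIV: "modes_prod UNIV = multi_prod"
  by (simp add: fun_eq_iff modes_prod_def multi_prod_def)

lemma modes_prod_empty [simp]: "modes_prod {} X A = X"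
  by (simp add: modes_prod_def)

lemma modes_prod_insert:
  "k \<notin> S \<Longrightarrow> modes_prod (insert k S) X A = mode_prod (modes_prod S X A) k (A $ k)"
proof -
  interpret comp_fun_commute "\<lambda>k Y. mode_prod Y k (A $ k)" by (rule comp_fun_commute_mode_prod)
  show "k \<notin> S \<Longrightarrow> ?thesis" by (simp add: modes_prod_def)
qed

lemma modes_prod_mode_prod:
  "k \<notin> S \<Longrightarrow> mode_prod (modes_prod S X A) k B = modes_prod S (mode_prod X k B) A"
proof (induction S rule: infinite_finite_induct)
  case (insert l S)
  then have "l \<noteq> k" by auto
  with insert show ?case by (simp add: modes_prod_insert mode_prod_commute)
qed auto

lemma modes_prod_modes_prod:
  "modes_prod S (modes_prod S X A) B = modes_prod S X (\<chi> k. B $ k ** A $ k)"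
proof (induction S rule: infinite_finite_induct)
  case (insert k S)
  then show ?case
    by (simp add: modes_prod_insert modes_prod_mode_prod[symmetric] mode_prod_mode_prod)
qed auto

lemma modes_prod_adjoint:
  "modes_prod S X A \<bullet> Y = X \<bullet> modes_prod S Y (\<chi> k. transpose (A $ k))"
proof (induction S arbitrary: Y rule: infinite_finite_induct)
  case (insert k S)
  let ?T = "\<chi> k. transpose (A $ k)"
  have "modes_prod (insert k S) X A \<bullet> Y = modes_prod S X A \<bullet> mode_prod Y k (?T $ k)"
    by (simp add: modes_prod_insert[OF insert(2)] mode_prod_adjoint)
  also have "\<dots> = X \<bullet> modes_prod S (mode_prod Y k (?T $ k)) ?T" by (rule insert)
  also have "\<dots> = X \<bullet> modes_prod (insert k S) Y ?T"
    by (simp only: modes_prod_insert[OF insert(2)] modes_prod_mode_prod[OF insert(2)])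
  finally show ?case .
qed auto

lemma Ck_on_modes_prod:
  assumes "Ck_on m W D F" "Ck_on m W D A"
  shows "Ck_on m W D (\<lambda>x. modes_prod S (F x) (A x))"
proof (induction S rule: infinite_finite_induct)
  case (insert k S)
  then show ?case unfolding modes_prod_insert[OF insert(2)]
    by (intro Ck_on_bilinear[OF bilinear_mode_prod] Ck_on_vec_nth assms)
qed (use assms in auto)

lemma linear_modes_prod: "bounded_linear (\<lambda>X. modes_prod S X A)"
proof (induction S rule: infinite_finite_induct)
  case (insert k S)
  from bounded_linear_compose[OF bounded_bilinear.bounded_linear_left[OF bilinear_mode_prod] insert(3)]
  show ?case unfolding modes_prod_insert[OF insert(2)] .
qed (auto intro: bounded_linear_ident)

lemmas Ck_on_multi_prod = Ck_on_modes_prod[where S = UNIV, unfolded modes_prod_UNIV]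
  and linear_multi_prod = linear_modes_prod[where S = UNIV, unfolded modes_prod_UNIV]
  and multi_prod_adjoint = modes_prod_adjoint[where S = UNIV, unfolded modes_prod_UNIV]
  and multi_prod_multi_prod = modes_prod_modes_prod[where S = UNIV, unfolded modes_prod_UNIV]

lemma multi_prod_split: "multi_prod X A = modes_prod (UNIV - {k}) (mode_prod X k (A $ k)) A"
  using modes_prod_insert[of k "UNIV - {k}" X A]
  by (simp add: modes_prod_UNIV modes_prod_mode_prod insert_absorb)

lemma mode_prod_multi_prod:
  "mode_prod (multi_prod X A) k B = modes_prod (UNIV - {k}) (mode_prod X k (B ** A $ k)) A"
  by (subst multi_prod_split[of _ _ k]) (simp add: modes_prod_mode_prod mode_prod_mode_prod)

lemma mode_prod_multi_prod_fixed:
  "B ** A $ k = A $ k \<Longrightarrow> mode_prod (multi_prod X A) k B = multi_prod X A"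
  by (metis mode_prod_multi_prod multi_prod_split)

lemma modes_prod_zero [simp]: "modes_prod S 0 A = 0"
  using bounded_linear.linear[OF linear_modes_prod] linear_0 by blast

lemma mode_prod_multi_prod_zero: "B ** A $ k = 0 \<Longrightarrow> mode_prod (multi_prod X A) k B = 0"
  by (simp add: mode_prod_multi_prod mode_prod_zero_right)

lemma modes_prod_fixed: "(\<And>k. mode_prod X k (A $ k) = X) \<Longrightarrow> modes_prod S X A = X"
  by (induction S rule: infinite_finite_induct) (auto simp: modes_prod_insert)

lemmas multi_prod_fixed = modes_prod_fixed[where S = UNIV, unfolded modes_prod_UNIV]

lemma multi_prod_tensors:
  "(\<And>k. idm (I k) ** A $ k = A $ k) \<Longrightarrow> multi_prod X A \<in> tensors I"
  by (simp add: tensors_iff mode_prod_multi_prod_fixed)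

text \<open>Expanding \<open>\<Prod>(Q k + P k)\<close>, only the terms with at most one factor \<open>P k\<close> survive.\<close>

lemma modes_prod_decompose:
  assumes QP: "\<And>k. mode_prod Y k (Q $ k) + mode_prod Y k (P $ k) = Y"
    and PP: "\<And>k l. k \<noteq> l \<Longrightarrow> mode_prod (mode_prod Y k (P $ k)) l (P $ l) = 0"
  shows "Y = modes_prod S Y Q + (\<Sum>k\<in>S. mode_prod Y k (P $ k))"
proof -
  have QE: "mode_prod Y k (Q $ k) = Y - mode_prod Y k (P $ k)" for k
    using QP[of k] by (metis add_diff_cancel_right')
  show ?thesis
  proof (induction S rule: infinite_finite_induct)
    case (insert l S)
    \<comment> \<open>A term that already carries \<open>P $ l\<close> is fixed by
      \<open>Q $ k\<close> for every other \<open>k\<close>: after commuting, \<open>QE\<close>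
      applies to \<open>Y\<close> itself, and the correction vanishes by \<open>PP\<close>.\<close>
    have fixed: "modes_prod S (mode_prod Y l (P $ l)) Q = mode_prod Y l (P $ l)"
    proof -
      have "modes_prod T (mode_prod Y l (P $ l)) Q = mode_prod Y l (P $ l)" if "l \<notin> T" for T
        using finite[of T] that
      proof (induction T)
        case (insert k T)
        then have "k \<noteq> l" by auto
        have "mode_prod (mode_prod Y l (P $ l)) k (Q $ k) = mode_prod (mode_prod Y k (Q $ k)) l (P $ l)"
          using \<open>k \<noteq> l\<close> by (rule mode_prod_commute[OF not_sym])
        also have "\<dots> = mode_prod (Y - mode_prod Y k (P $ k)) l (P $ l)"
          by (simp only: QE)
        also have "\<dots> = mode_prod Y l (P $ l)"
          using PP[OF \<open>k \<noteq> l\<close>] by (simp add: mode_prod_diff_left)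
        finally show ?case using insert by (simp add: modes_prod_insert)
      qed simp
      then show ?thesis using insert by blast
    qed
    have "modes_prod (insert l S) Y Q = modes_prod S (mode_prod Y l (Q $ l)) Q"
      using insert by (simp add: modes_prod_insert modes_prod_mode_prod)
    also have "mode_prod Y l (Q $ l) = Y - mode_prod Y l (P $ l)"
      by (rule QE)
    also have "modes_prod S (Y - mode_prod Y l (P $ l)) Q = modes_prod S Y Q - mode_prod Y l (P $ l)"
      using fixed linear_diff[OF bounded_linear.linear[OF linear_modes_prod]] by metis
    finally have "modes_prod S Y Q + (\<Sum>k\<in>S. mode_prod Y k (P $ k)) =
        modes_prod (insert l S) Y Q + (\<Sum>k\<in>insert l S. mode_prod Y k (P $ k))"
      using insert(1,2) by simp
    then show ?case by (rule trans[OF insert(3)])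
  qed auto
qed

section \<open>Frames of the Grassmannian\<close>

lemma rank_idm: "rank (idm A) = card A"
proof -
  have comp: "(idm A *v x) $ i = (if i \<in> A then x $ i else 0)" for x :: "real^'a" and i
  proof -
    have "(idm A *v x) $ i = (\<Sum>k\<in>UNIV. if k = i then (if i \<in> A then x $ i else 0) else 0)"
      unfolding matrix_vector_mult_def vec_lambda_beta by (rule sum.cong) (auto simp: idm_def)
    then show ?thesis by simp
  qed
  have "range (\<lambda>x. idm A *v x) = {x. \<forall>i. i \<notin> A \<longrightarrow> x $ i = 0}"
  proof safe
    fix x :: "real^'a" assume "\<forall>i. i \<notin> A \<longrightarrow> x $ i = 0"
    then have "x = idm A *v x" by (simp add: vec_eq_iff comp)
    then show "x \<in> range (\<lambda>x. idm A *v x)" by blast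
  qed (simp add: comp)
  then show ?thesis
    using dim_substandard_cart[of A, where 'a = real] by (simp add: rank_dim_range dim_vec_eq)
qed

text \<open>Inside the range of \<open>idm A\<close>, the range of \<open>idm A - P\<close> is
  exactly the orthogonal complement of the range of \<open>P\<close>, so the dimensions add
  up.\<close>

lemma rank_complement:
  assumes "P \<in> mats A A" "transpose P = P" "P ** P = P"
  shows "rank P + rank (idm A - P) = card A"
proof -
  let ?R = "\<lambda>M::real^'a^'a. range (\<lambda>x. M *v x)"
  have sub: "subspace (?R M)" for M
    using linear_subspace_image[OF matrix_vector_mul_linear subspace_UNIV] .
  have IP: "idm A ** P = P" "P ** idm A = P" using assms(1) by (simp_all add: mats_iff)
  have adj: "(M *v x) \<bullet> y = x \<bullet> (transpose M *v y)" for M :: "real^'a^'a" and x y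
    using dot_lmul_matrix[of x "transpose M" y] by (metis transpose_matrix_vector transpose_transpose)
  have le: "?R P \<subseteq> ?R (idm A)"
  proof safe
    fix x have "P *v x = idm A *v (P *v x)" using IP by (simp add: matrix_vector_mul_assoc)
    then show "P *v x \<in> ?R (idm A)" by blast
  qed
  have "{y \<in> ?R (idm A). \<forall>x\<in>?R P. orthogonal x y} = ?R (idm A - P)"
  proof safe
    fix y assume "\<forall>x\<in>?R P. orthogonal x (idm A *v y)"
    then have "orthogonal (P *v (P *v y)) (idm A *v y)" by blast
    then have "(P *v y) \<bullet> (P *v y) = 0"
      using adj[of P "P *v y" y] adj[of "idm A" "P *v y" y] IP assms(2,3)
      by (simp add: orthogonal_def matrix_vector_mul_assoc adj)
    then have "idm A *v y = (idm A - P) *v y" by (simp add: matrix_vector_mult_diff_rdistrib)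
    then show "idm A *v y \<in> ?R (idm A - P)" by blast
  next
    fix y
    have "(idm A - P) *v y = idm A *v ((idm A - P) *v y)"
      using IP by (simp add: matrix_vector_mul_assoc matrix_diff_ldistrib)
    then show "(idm A - P) *v y \<in> ?R (idm A)" by blast
  next
    fix x y
    have "P *v ((idm A - P) *v y) = 0"
      using IP assms(3) by (simp add: matrix_vector_mul_assoc matrix_diff_ldistrib)
    then show "orthogonal (P *v x) ((idm A - P) *v y)"
      unfolding orthogonal_def adj assms(2) by simp
  qed
  then have "dim (?R (idm A - P)) + dim (?R P) = dim (?R (idm A))"
    using dim_subspace_orthogonal_to_vectors[OF sub sub le] by simp
  then show ?thesis using rank_idm[of A] by (simp add: rank_dim_range)
qed

text \<open>The complementary projection \<open>Q\<close> has rank \<open>card B\<close>; an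
  orthonormal basis of its range, enumerated by \<open>B\<close>, supplies the columns of
  \<open>U\<close>.\<close>

lemma Gr_orthonormal_frame:
  fixes A B :: "'n::finite set"
  assumes "P \<in> Gr (card A - card B) A" "card B \<le> card A"
  obtains U where "U \<in> St B A" "P = idm A - U ** transpose U"
proof -
  define Q where "Q = idm A - P"
  have P: "P \<in> mats A A" "transpose P = P" "P ** P = P" "rank P = card A - card B"
    using assms by (auto simp: Gr_def)
  have IP: "idm A ** P = P" "P ** idm A = P" using P(1) by (simp_all add: mats_iff)
  have Q: "Q \<in> mats A A" "transpose Q = Q" "Q ** Q = Q"
    using P IP by (auto simp: Q_def transpose_diff matrix_diff_ldistrib matrix_diff_rdistrib mats_diff)
  have "rank Q = card B" using rank_complement[OF P(1-3)] P(4) assms(2) by (simp add: Q_def)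
  let ?V = "range (\<lambda>x. Q *v x)"
  have "subspace ?V"
    using linear_subspace_image[OF matrix_vector_mul_linear subspace_UNIV] .
  then obtain C where C: "C \<subseteq> ?V" "pairwise orthogonal C" "\<And>x. x \<in> C \<Longrightarrow> norm x = 1"
      "independent C" "card C = dim ?V" "span C = ?V"
    using orthonormal_basis_subspace by metis
  have "card C = card B" "finite C"
    using C \<open>rank Q = card B\<close> by (auto simp: rank_dim_range independent_imp_finite)
  then obtain b where b: "bij_betw b B C" by (metis bij_betw_iff_card finite)
  define U :: "real^'n^'n" where "U = (\<chi> i j. if j \<in> B then b j $ i else 0)"
  have col: "column j U = (if j \<in> B then b j else 0)" for j
    by (simp add: U_def column_def vec_eq_iff)
  have bC: "j \<in> B \<Longrightarrow> b j \<in> C" for j using b by (auto simp: bij_betw_def)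
  have QC: "Q *v x = x" if "x \<in> C" for x
    using that C(1) Q(3) by (force simp: matrix_vector_mul_assoc)
  have ext: "M = N" if "\<And>j. column j M = column j N" for M N :: "real^'n^'n"
    using that by (simp add: column_def vec_eq_iff)
  have colm: "column j (M ** N) = M *v column j N" for j and M N :: "real^'n^'n"
    by (simp add: column_def vec_eq_iff matrix_matrix_mult_def matrix_vector_mult_def)
  have QU: "Q ** U = U"
    by (rule ext) (simp add: colm col QC bC)
  have UI: "U ** idm B = U"
    by (simp add: vec_eq_iff mult_idm_component) (simp add: U_def)
  have UU: "transpose U ** U = idm B"
  proof -
    have "(transpose U ** U) $ i $ j = column i U \<bullet> column j U" for i j
      by (simp add: matrix_matrix_mult_def transpose_def column_def inner_vec_def)
    moreover have "b i \<bullet> b j = (if i = j then 1 else 0)" if "i \<in> B" "j \<in> B" for i j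
    proof (cases "i = j")
      case True
      then show ?thesis using C(3)[OF bC[OF that(1)]] by (simp add: norm_eq_1)
    next
      case False
      then have "b i \<noteq> b j" using b that by (auto simp: bij_betw_def inj_on_def)
      then show ?thesis using C(2) bC that False by (auto simp: pairwise_def orthogonal_def)
    qed
    ultimately show ?thesis by (auto simp: vec_eq_iff idm_def col)
  qed
  have WC: "(U ** transpose U) *v x = x" if "x \<in> C" for x
  proof -
    obtain j where j: "j \<in> B" "x = b j" using \<open>x \<in> C\<close> b unfolding bij_betw_def by blast
    then have x: "x = column j U" by (simp add: col)
    have "(U ** transpose U) *v x = column j (U ** (transpose U ** U))"
      by (simp add: x colm[symmetric] matrix_mul_assoc)
    then show ?thesis by (simp add: UU UI x)
  qed
  have "(U ** transpose U) *v x = x" if "x \<in> ?V" for x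
  proof -
    have "subspace {x. (U ** transpose U) *v x = x}"
      by (auto simp: subspace_def matrix_vector_right_distrib scaleR_matrix_vector_assoc[symmetric]
         matrix_vector_mult_scaleR)
    then have "span C \<subseteq> {x. (U ** transpose U) *v x = x}" using WC by (intro span_minimal) auto
    then show ?thesis using that C(6) by blast
  qed
  moreover have colQ: "column j Q \<in> ?V" for j
    using colm[of j Q "mat 1"] by (metis matrix_mul_rid rangeI)
  ultimately have "(U ** transpose U) ** Q = Q"
    using colQ by (intro ext) (simp add: colm)
  \<comment> \<open>Transposition turns this into \<open>Q ** (U ** transpose U) = Q\<close>,
    whereas \<open>Q ** U = U\<close> makes the left side \<open>U ** transpose U\<close>.\<close>
  then have "transpose Q ** transpose (U ** transpose U) = transpose Q"
    by (metis matrix_transpose_mul)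
  then have "Q ** (U ** transpose U) = Q" using Q by (simp add: matrix_transpose_mul)
  then have "U ** transpose U = Q" by (simp add: matrix_mul_assoc QU)
  then have "P = idm A - U ** transpose U" by (simp add: Q_def)
  moreover have "idm A ** U = U" using QU Q(1) by (metis mats_iff matrix_mul_assoc)
  ultimately show ?thesis using that UU UI by (simp add: St_def mats_iff)
qed

text \<open>
  Adding \<open>mat 1 - idm B\<close> pads the Gram matrix of the frame, so that an ordinary matrix inverse
  can be used.
\<close>

lemma frame_projection_Gr:
  fixes U :: "real^'n::finite^'n" and A B :: "'n set"
  defines "S \<equiv> transpose U ** U + (mat 1 - idm B)"
  assumes U: "U \<in> mats A B" and "det S \<noteq> 0"
  defines "P \<equiv> idm A - U ** matrix_inv S ** transpose U"
  shows "P \<in> Gr (card A - card B) A" "P ** U = 0"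
proof -
  define K where "K = matrix_inv S"
  have K: "S ** K = mat 1" "K ** S = mat 1" using matrix_inv_inverse[OF \<open>det S \<noteq> 0\<close>] by (auto simp: K_def)
  have U1: "idm A ** U = U" "U ** idm B = U" using U by (auto simp: mats_iff)
  have U2: "transpose U ** idm A = transpose U" "idm B ** transpose U = transpose U"
    using U1 by (metis matrix_transpose_mul transpose_idm)+
  \<comment> \<open>The padding vanishes on \<open>B\<close>, so the full inverse \<open>K\<close>
    of \<open>S\<close> restricts there to an inverse of the Gram matrix.\<close>
  have SB: "S ** idm B = transpose U ** U" "idm B ** S = transpose U ** U"
    using U1 U2 by (simp_all add: S_def matrix_add_rdistrib matrix_add_ldistrib
        matrix_diff_rdistrib matrix_diff_ldistrib matrix_mul_assoc[symmetric]) 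
       (simp add: matrix_mul_assoc)
  have "K ** (transpose U ** U) = (K ** S) ** idm B" by (simp add: SB(1)[symmetric] matrix_mul_assoc)
  then have KU: "K ** (transpose U ** U) = idm B" by (simp add: K)
  have "transpose S = S"
    by (simp add: S_def transpose_add transpose_diff matrix_transpose_mul)
  have "transpose K = transpose K ** (S ** K)" by (simp add: K)
  also have "\<dots> = transpose (S ** K) ** K"
    using \<open>transpose S = S\<close> by (simp add: matrix_transpose_mul matrix_mul_assoc)
  finally have TK: "transpose K = K" by (simp add: K)
  let ?W = "U ** K ** transpose U"
  have WU: "?W ** U = U"
    using KU U1 by (metis matrix_mul_assoc)
  have WW: "?W ** ?W = ?W" 
    using WU by (simp add: matrix_mul_assoc)
  have W: "?W \<in> mats A A" using U1 U2 by (intro mats_mult3)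
  have TW: "transpose ?W = ?W" by (simp add: matrix_transpose_mul TK matrix_mul_assoc)
  \<comment> \<open>The rank is sandwiched: \<open>?W\<close> factors through \<open>idm B\<close>,
    and \<open>idm B\<close> factors through \<open>?W\<close>.\<close>
  have "rank ?W \<le> rank (idm B)"
    by (metis U1(2) le_trans matrix_mul_assoc rank_mul_le_left rank_mul_le_right)
  moreover have "idm B = K ** transpose U ** (?W ** U)" using WU KU by (simp add: matrix_mul_assoc)
  then have "rank (idm B) \<le> rank ?W" by (metis le_trans rank_mul_le_left rank_mul_le_right)
  ultimately have "rank ?W = card B" by (simp add: rank_idm)
  then have "rank P = card A - card B"
    using rank_complement[OF W TW WW] by (simp add: P_def K_def)
  then show "P \<in> Gr (card A - card B) A"
    using W TW WW idm_mult[OF W] mult_idm[OF W]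
    by (auto simp: Gr_def P_def K_def[symmetric] mats_diff transpose_diff
        matrix_diff_ldistrib matrix_diff_rdistrib)
  show "P ** U = 0" using WU U1 by (simp add: P_def K_def[symmetric] matrix_diff_rdistrib)
qed

section \<open>Stationarity in terms of ambient gradient fields\<close>

lemma orth_proj_exists1:
  fixes T :: "'a::euclidean_space set"
  assumes "subspace T" shows "\<exists>!w. w \<in> T \<and> (\<forall>z\<in>T. (v - w) \<bullet> z = 0)"
proof -
  obtain y z where "y \<in> span T" "\<And>w. w \<in> span T \<Longrightarrow> orthogonal z w" "v = y + z"
    using orthogonal_subspace_decomp_exists[of T v] by metis
  then have "y \<in> T \<and> (\<forall>z\<in>T. (v - y) \<bullet> z = 0)"
    using assms by (auto simp: orthogonal_def span_eq_iff[THEN iffD2])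
  moreover have "a = b" if "a \<in> T" "b \<in> T" "\<forall>z\<in>T. (v - a) \<bullet> z = 0" "\<forall>z\<in>T. (v - b) \<bullet> z = 0" for a b
  proof -
    have "a - b \<in> T" using that assms by (simp add: subspace_diff)
    then have "(v - b) \<bullet> (a - b) - (v - a) \<bullet> (a - b) = 0" using that by simp
    then have "(a - b) \<bullet> (a - b) = 0" by (simp add: algebra_simps)
    then show ?thesis by simp
  qed
  ultimately show ?thesis by blast
qed

lemma orth_proj:
  assumes "subspace T"
  shows "orth_proj T v \<in> T" "z \<in> T \<Longrightarrow> orth_proj T v \<bullet> z = v \<bullet> z"
proof -
  have *: "orth_proj T v \<in> T \<and> (\<forall>z\<in>T. (v - orth_proj T v) \<bullet> z = 0)"
    unfolding orth_proj_def using theI'[OF orth_proj_exists1[OF assms]] by blast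
  from * show "orth_proj T v \<in> T" by blast
  assume "z \<in> T"
  with * have "(v - orth_proj T v) \<bullet> z = 0" by blast
  then show "orth_proj T v \<bullet> z = v \<bullet> z" by (simp add: inner_diff_left)
qed

lemma orth_proj_eqI:
  assumes "subspace T" "w \<in> T" "\<And>z. z \<in> T \<Longrightarrow> v \<bullet> z = w \<bullet> z" shows "orth_proj T v = w"
proof -
  have "\<forall>z\<in>T. (v - w) \<bullet> z = 0" using assms(3) by (simp add: inner_diff_left)
  then show ?thesis
    unfolding orth_proj_def using orth_proj_exists1[OF assms(1), of v] assms(2) by (intro the1_equality) auto
qed

lemma bounded_linear_orth_proj:
  fixes T :: "'a::euclidean_space set"
  assumes "subspace T" shows "bounded_linear (orth_proj T)"
proof -
  have "orth_proj T (v + w) = orth_proj T v + orth_proj T w" for v w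
    by (rule orth_proj_eqI[OF assms])
       (auto simp: inner_add_left orth_proj[OF assms] subspace_add[OF assms])
  moreover have "orth_proj T (c *\<^sub>R v) = c *\<^sub>R orth_proj T v" for c v
    by (rule orth_proj_eqI[OF assms]) (auto simp: orth_proj[OF assms] subspace_mul[OF assms])
  ultimately show ?thesis by (simp add: linearI linear_conv_bounded_linear[symmetric])
qed

lemma has_derivative_within_subspace_line:
  assumes "(F has_derivative D) (at (x + t *\<^sub>R h) within W)" "subspace W" "x \<in> W" "h \<in> W"
  shows "((\<lambda>t. F (x + t *\<^sub>R h)) has_vector_derivative D h) (at t)"
proof -
  have "((\<lambda>t. x + t *\<^sub>R h) has_derivative (\<lambda>s. s *\<^sub>R h)) (at t)"
    by (auto intro!: derivative_eq_intros)
  moreover have "range (\<lambda>t. x + t *\<^sub>R h) \<subseteq> W"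
    using assms by (auto intro: subspace_add subspace_mul)
  ultimately have "((\<lambda>t. F (x + t *\<^sub>R h)) has_derivative (\<lambda>s. D (s *\<^sub>R h))) (at t)"
    using has_derivative_in_compose[of "\<lambda>t. x + t *\<^sub>R h" _ t UNIV F D] has_derivative_subset[OF assms(1)]
    by blast
  moreover have "linear D" using assms(1) has_derivative_linear by blast
  ultimately show ?thesis unfolding has_vector_derivative_def by (simp add: linear_cmul)
qed

text \<open>Lines through \<open>x\<close> in directions of \<open>W\<close> stay in
  \<open>W\<close>, which reduces the claim to uniqueness of derivatives in one real
  variable.\<close>

lemma has_derivative_within_subspace_unique:
  assumes "(F has_derivative D) (at x within W)" "(F has_derivative E) (at x within W)"
    "subspace W" "x \<in> W" "h \<in> W"
  shows "D h = E h"
  using has_derivative_within_subspace_line[of F D x 0 h W]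
    has_derivative_within_subspace_line[of F E x 0 h W] assms
  by (auto intro: vector_derivative_unique_at)

text \<open>The gradient within \<open>W\<close> is the orthogonal projection of any field
  \<open>G\<close> representing the derivative, and projecting does not change inner products with
  \<open>W\<close>. Hence \<open>G\<close> and its derivative \<open>H\<close> can replace the
  definite descriptions without having values in \<open>W\<close>.\<close>

lemma second_order_stationary_iff:
  fixes W :: "'a::euclidean_space set"
  assumes W: "subspace W"
    and g: "\<And>x. x \<in> W \<Longrightarrow> (g has_derivative (\<lambda>h. G x \<bullet> h)) (at x within W)"
    and G: "\<And>x. x \<in> W \<Longrightarrow> (G has_derivative H x) (at x within W)"
  shows "second_order_stationary W g x \<longleftrightarrow>
    x \<in> W \<and> (\<forall>h\<in>W. G x \<bullet> h = 0) \<and> (\<forall>h\<in>W. 0 \<le> h \<bullet> H x h)"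
proof (cases "x \<in> W")
  case True
  have grad: "grad W g y = orth_proj W (G y)" if "y \<in> W" for y
  proof -
    have d: "(g has_derivative (\<lambda>h. w \<bullet> h)) (at y within W) \<longleftrightarrow> (\<forall>h\<in>W. w \<bullet> h = G y \<bullet> h)" if "w \<in> W" for w
    proof
      assume "(g has_derivative (\<lambda>h. w \<bullet> h)) (at y within W)"
      then show "\<forall>h\<in>W. w \<bullet> h = G y \<bullet> h"
        using has_derivative_within_subspace_unique[OF _ g[OF \<open>y \<in> W\<close>] W \<open>y \<in> W\<close>] by blast
    next
      assume *: "\<forall>h\<in>W. w \<bullet> h = G y \<bullet> h"
      \<comment> \<open>Agreement on \<open>W\<close> does not make the two linear maps equal.
        Composing with the projection leaves \<open>g\<close> unchanged on \<open>W\<close> but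
        replaces its derivative by one depending only on the projected direction.\<close>
      have "((\<lambda>z. g (orth_proj W z)) has_derivative (\<lambda>h. G (orth_proj W y) \<bullet> (orth_proj W h))) (at y within W)"
        using orth_proj(1)[OF W]
        by (intro has_derivative_in_compose2[where g = g and t = W, OF g _ \<open>y \<in> W\<close>]
              bounded_linear_imp_has_derivative bounded_linear_orth_proj[OF W]) auto
      moreover have "orth_proj W z = z" if "z \<in> W" for z
        using that W by (intro orth_proj_eqI) auto
      moreover have "(\<lambda>h. G y \<bullet> (orth_proj W h)) = (\<lambda>h. w \<bullet> h)"
      proof
        fix h
        have "w \<bullet> h = h \<bullet> w" by (rule inner_commute)
        also have "\<dots> = w \<bullet> orth_proj W h" 
          using orth_proj(2)[OF W \<open>w \<in> W\<close>] by (simp add: inner_commute)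
        finally show "G y \<bullet> (orth_proj W h) = w \<bullet> h" using * orth_proj(1)[OF W] by simp
      qed
      ultimately have "((\<lambda>z. g (orth_proj W z)) has_derivative (\<lambda>h. w \<bullet> h)) (at y within W)"
        using \<open>y \<in> W\<close> by simp
      then show "(g has_derivative (\<lambda>h. w \<bullet> h)) (at y within W)"
        using \<open>\<And>z. z \<in> W \<Longrightarrow> orth_proj W z = z\<close>
        by (intro has_derivative_transform[OF \<open>y \<in> W\<close>, of g "\<lambda>z. g (orth_proj W z)"]) auto
    qed
    have "grad W g y = (THE w. w \<in> W \<and> (\<forall>z\<in>W. (G y - w) \<bullet> z = 0))"
      unfolding grad_def
      by (rule arg_cong[where f = The], rule ext) (auto simp: d inner_diff_left cong: conj_cong)
    then show ?thesis by (simp add: orth_proj_def)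
  qed
  have "((\<lambda>y. orth_proj W (G y)) has_derivative (\<lambda>h. orth_proj W (H x h))) (at x within W)"
    by (rule bounded_linear.has_derivative[OF bounded_linear_orth_proj[OF W] G[OF True]])
  then have dgrad: "(grad W g has_derivative (\<lambda>h. orth_proj W (H x h))) (at x within W)"
    using grad by (intro has_derivative_transform[OF True, of "grad W g"]) auto
  have hess: "hess W g x h = orth_proj W (H x h)" if "h \<in> W" for h
    unfolding hess_def using dgrad has_derivative_within_subspace_unique[OF _ dgrad W True that]
    by (intro the_equality) blast+
  have "grad W g x = 0 \<longleftrightarrow> (\<forall>h\<in>W. G x \<bullet> h = 0)"
  proof
    assume "grad W g x = 0"
    then show "\<forall>h\<in>W. G x \<bullet> h = 0"
      using orth_proj(2)[OF W, of _ "G x"] True by (simp add: grad)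
  next
    assume "\<forall>h\<in>W. G x \<bullet> h = 0"
    then show "grad W g x = 0"
      using W True by (auto simp: grad intro!: orth_proj_eqI subspace_0)
  qed
  moreover have "h \<bullet> hess W g x h = h \<bullet> H x h" if "h \<in> W" for h
    using that hess orth_proj(2)[OF W that] by (simp add: inner_commute)
  ultimately show ?thesis using True by (simp add: second_order_stationary_def)
qed (simp add: second_order_stationary_def)

section \<open>Differentials along curves and the Riemannian Hessian\<close>

lemma curve_through_has_vector_derivative:
  assumes "curve_through M x v c" "(F has_derivative D) (at x within M)"
  shows "((\<lambda>t. F (c t)) has_vector_derivative D v) (at 0)"
proof -
  from assms(1) obtain e where e: "e > 0" "c ` {-e<..<e} \<subseteq> M" and c: "c 0 = x"
    "(c has_vector_derivative v) (at 0)" unfolding curve_through_def by blast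
  have o: "at 0 within {-e<..<e} = at (0::real)" using e by (intro at_within_open) auto
  have "(c has_derivative (\<lambda>s. s *\<^sub>R v)) (at 0 within {-e<..<e})"
    using c(2) unfolding has_vector_derivative_def o .
  moreover have "(F has_derivative D) (at (c 0) within c ` {-e<..<e})"
    using assms(2) e(2) c(1) has_derivative_subset by blast
  ultimately have "((\<lambda>t. F (c t)) has_derivative (\<lambda>s. D (s *\<^sub>R v))) (at 0 within {-e<..<e})"
    by (rule has_derivative_in_compose)
  moreover have "linear D" using assms(2) has_derivative_linear by blast
  ultimately show ?thesis unfolding has_vector_derivative_def o by (simp add: linear_cmul)
qed

text \<open>All curves with velocity \<open>v\<close> give the value \<open>D v\<close>, and
  tangency provides at least one such curve, so the description in \<open>mdiff\<close> is
  unique.\<close>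

lemma mdiff_eq:
  assumes "(F has_derivative D) (at x within M)" "v \<in> tangent_space M x"
  shows "mdiff M F x v = D v"
proof -
  obtain c where c: "curve_through M x v c" using assms(2) unfolding tangent_space_def by blast
  show ?thesis unfolding mdiff_def
  proof (rule the_equality)
    show "\<forall>c. curve_through M x v c \<longrightarrow> ((\<lambda>t. F (c t)) has_vector_derivative D v) (at 0)"
      using curve_through_has_vector_derivative assms(1) by blast
  next
    fix w assume "\<forall>c. curve_through M x v c \<longrightarrow> ((\<lambda>t. F (c t)) has_vector_derivative w) (at 0)"
    then show "w = D v"
      using c curve_through_has_vector_derivative[OF c assms(1)] vector_derivative_unique_at by blast
  qed
qed

text \<open>A tangent field representing the differential is the Riemannian gradient, and pairing
  with a tangent vector absorbs the projection in the Levi-Civita derivative. So the Hessian form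
  can be read off from any derivative of \<open>w\<close> within \<open>M\<close>.\<close>

lemma riem_second_order_stationary_iff:
  fixes M :: "'a::euclidean_space set"
  assumes T: "\<And>y. y \<in> M \<Longrightarrow> subspace (tangent_space M y)"
    and w: "\<And>y. y \<in> M \<Longrightarrow> w y \<in> tangent_space M y"
    and g: "\<And>y. y \<in> M \<Longrightarrow> (g has_derivative D y) (at y within M)"
    and wD: "\<And>y v. y \<in> M \<Longrightarrow> v \<in> tangent_space M y \<Longrightarrow> w y \<bullet> v = D y v"
    and dw: "\<And>y. y \<in> M \<Longrightarrow> (w has_derivative H y) (at y within M)"
  shows "riem_second_order_stationary M g x \<longleftrightarrow>
    x \<in> M \<and> w x = 0 \<and> (\<forall>u\<in>tangent_space M x. 0 \<le> u \<bullet> H x u)"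
proof (cases "x \<in> M")
  case True
  have grad: "riem_grad M g y = w y" if "y \<in> M" for y
    unfolding riem_grad_def
  proof (rule the_equality)
    show "w y \<in> tangent_space M y \<and> (\<forall>v\<in>tangent_space M y. w y \<bullet> v = mdiff M g y v)"
      using that w wD by (simp add: mdiff_eq[OF g[OF that]])
  next
    fix z assume z: "z \<in> tangent_space M y \<and> (\<forall>v\<in>tangent_space M y. z \<bullet> v = mdiff M g y v)"
    have "z - w y \<in> tangent_space M y" using z w that T by (simp add: subspace_diff)
    then have "(z - w y) \<bullet> (z - w y) = 0"
      using z wD that by (simp add: inner_diff_left mdiff_eq[OF g[OF that]])
    then show "z = w y" by simp
  qed
  have "(riem_grad M g has_derivative H x) (at x within M)"
    using dw[OF True] grad by (intro has_derivative_transform[OF True, of "riem_grad M g" w]) auto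
  then have "riem_hess M g x u = orth_proj (tangent_space M x) (H x u)" if "u \<in> tangent_space M x" for u
    using that by (simp add: riem_hess_def mdiff_eq)
  then have "u \<bullet> riem_hess M g x u = u \<bullet> H x u" if "u \<in> tangent_space M x" for u
    using that orth_proj(2)[OF T[OF True] that] by (simp add: inner_commute)
  then show ?thesis using True grad by (simp add: riem_second_order_stationary_def)
qed (simp add: riem_second_order_stationary_def)

section \<open>The tangent spaces of the desingularization\<close>

lemma desing_manifold_iff:
  "x \<in> desing_manifold I J \<longleftrightarrow> fst x \<in> tensors I \<and>
     (\<forall>k. snd x $ k \<in> Gr (card (I k) - card (J k)) (I k) \<and> mode_prod (fst x) k (snd x $ k) = 0)"
  by (auto simp: desing_manifold_def case_prod_unfold)

lemma tucker_space_iff: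
  "p \<in> tucker_space I J \<longleftrightarrow> fst p \<in> tensors J \<and> (\<forall>k. snd p $ k \<in> mats (I k) (J k))"
  by (auto simp: tucker_space_def case_prod_unfold)

lemma subspace_tucker_space: "subspace (tucker_space I J)"
  unfolding subspace_def
  by (auto simp: tucker_space_iff intro!: mats_add mats_scaleR subspace_add[OF subspace_tensors]
      subspace_mul[OF subspace_tensors] subspace_0[OF subspace_tensors] subspace_0[OF subspace_mats])

lemma desing_manifoldD:
  assumes "x \<in> desing_manifold I J"
  shows "fst x \<in> tensors I" "mode_prod (fst x) k (snd x $ k) = 0"
    "snd x $ k \<in> mats (I k) (I k)" "transpose (snd x $ k) = snd x $ k"
    "snd x $ k ** snd x $ k = snd x $ k"
    "idm (I k) ** snd x $ k = snd x $ k" "snd x $ k ** idm (I k) = snd x $ k"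
  using assms by (auto simp: desing_manifold_iff Gr_def mats_iff)

text \<open>The linearization at \<open>x\<close> of the equations for symmetric projections and for
  \<open>mode_prod X k (P $ k) = 0\<close>. A priori it only bounds the tangent space from above;
  equality follows once every element is lifted to a curve.\<close>

definition desing_tangent ::
  "('d::finite \<Rightarrow> 'n::finite set) \<Rightarrow> ('d, 'n) point \<Rightarrow> ('d, 'n) point set" where
  "desing_tangent I x = {v. fst v \<in> tensors I \<and> (\<forall>k. snd v $ k \<in> mats (I k) (I k) \<and>
     transpose (snd v $ k) = snd v $ k \<and>
     snd v $ k ** snd x $ k + snd x $ k ** snd v $ k = snd v $ k \<and>
     mode_prod (fst v) k (snd x $ k) + mode_prod (fst x) k (snd v $ k) = 0)}"

lemma subspace_desing_tangent: "subspace (desing_tangent I x)"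
proof (rule subspaceI)
  show "0 \<in> desing_tangent I x"
    by (simp add: desing_tangent_def subspace_0[OF subspace_tensors] mats_0 mode_prod_zero_left
        mode_prod_zero_right) (simp add: transpose_def vec_eq_iff)
next
  fix v w assume v: "v \<in> desing_tangent I x" "w \<in> desing_tangent I x"
  show "v + w \<in> desing_tangent I x"
    unfolding desing_tangent_def mem_Collect_eq
  proof (intro conjI allI)
    show "fst (v + w) \<in> tensors I"
      using v subspace_add[OF subspace_tensors] by (auto simp: desing_tangent_def)
    fix k
    have e: "snd v $ k ** snd x $ k + snd x $ k ** snd v $ k = snd v $ k"
      "mode_prod (fst v) k (snd x $ k) + mode_prod (fst x) k (snd v $ k) = 0"
      "snd w $ k ** snd x $ k + snd x $ k ** snd w $ k = snd w $ k"
      "mode_prod (fst w) k (snd x $ k) + mode_prod (fst x) k (snd w $ k) = 0"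
      using v by (auto simp: desing_tangent_def)
    show "snd (v + w) $ k \<in> mats (I k) (I k)" "transpose (snd (v + w) $ k) = snd (v + w) $ k"
      using v by (auto simp: desing_tangent_def mats_add transpose_add)
    have "snd (v + w) $ k ** snd x $ k + snd x $ k ** snd (v + w) $ k =
      (snd v $ k ** snd x $ k + snd x $ k ** snd v $ k) + (snd w $ k ** snd x $ k + snd x $ k ** snd w $ k)"
      by (simp add: matrix_add_ldistrib matrix_add_rdistrib)
    then show "snd (v + w) $ k ** snd x $ k + snd x $ k ** snd (v + w) $ k = snd (v + w) $ k"
      by (simp add: e)
    have "mode_prod (fst (v + w)) k (snd x $ k) + mode_prod (fst x) k (snd (v + w) $ k) =
      (mode_prod (fst v) k (snd x $ k) + mode_prod (fst x) k (snd v $ k)) +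
      (mode_prod (fst w) k (snd x $ k) + mode_prod (fst x) k (snd w $ k))"
      by (simp add: mode_prod_add_left mode_prod_add_right)
    then show "mode_prod (fst (v + w)) k (snd x $ k) + mode_prod (fst x) k (snd (v + w) $ k) = 0"
      by (simp add: e)
  qed
next
  fix c :: real and v assume "v \<in> desing_tangent I x"
  then show "c *\<^sub>R v \<in> desing_tangent I x"
    by (simp add: desing_tangent_def subspace_mul[OF subspace_tensors] mats_scaleR transpose_scalar
        mode_prod_scaleR_left mode_prod_scaleR_right matrix_scaleR_left matrix_scaleR_right
        flip: scaleR_add_right)
qed

lemma has_vector_derivative_eq_on_open:
  assumes "(\<phi> has_vector_derivative w) (at t)" "(\<psi> has_vector_derivative z) (at t)"
    "open S" "t \<in> S" "\<And>s. s \<in> S \<Longrightarrow> \<phi> s = \<psi> s"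
  shows "w = z"
proof -
  have "(\<psi> has_vector_derivative w) (at t)"
    by (rule has_vector_derivative_transform_within_open[OF assms(1,3,4,5)])
  then show ?thesis using assms(2) vector_derivative_unique_at by blast
qed

text \<open>Each defining equation holds along the curve and is differentiated by the product rule.
  The time \<open>t0\<close> is arbitrary because the Hessian comparison needs tangency on a whole
  interval.\<close>

lemma velocity_in_desing_tangent:
  assumes c: "(c has_vector_derivative v) (at t0)" and S: "open S" "t0 \<in> S"
    and M: "\<And>t. t \<in> S \<Longrightarrow> c t \<in> desing_manifold I J"
  shows "v \<in> desing_tangent I (c t0)"
proof -
  note eqI = has_vector_derivative_eq_on_open[OF _ _ S]
  have X: "((\<lambda>t. fst (c t)) has_vector_derivative fst v) (at t0)"
    by (rule bounded_linear.has_vector_derivative[OF bounded_linear_fst c])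
  have P: "((\<lambda>t. snd (c t) $ k) has_vector_derivative snd v $ k) (at t0)" for k
    by (intro bounded_linear.has_vector_derivative[OF bounded_linear_vec_nth]
        bounded_linear.has_vector_derivative[OF bounded_linear_snd c])
  note mult = bounded_bilinear.has_vector_derivative[OF bounded_bilinear_matrix_matrix_mult]
    and mode = bounded_bilinear.has_vector_derivative[OF bilinear_mode_prod]
    and const = has_vector_derivative_const
  show ?thesis
    unfolding desing_tangent_def mem_Collect_eq tensors_iff mats_iff
  proof (intro conjI allI)
    fix k
    show "mode_prod (fst v) k (idm (I k)) = fst v"
    proof (rule eqI)
      show "((\<lambda>t. mode_prod (fst (c t)) k (idm (I k))) has_vector_derivative mode_prod (fst v) k (idm (I k))) (at t0)"
        using mode[OF X const[of "idm (I k)"]] by (simp add: mode_prod_zero_right)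
      show "mode_prod (fst (c t)) k (idm (I k)) = fst (c t)" if "t \<in> S" for t
        using desing_manifoldD(1)[OF M[OF that]] by (simp add: tensors_iff)
    qed (rule X)
    show "idm (I k) ** snd v $ k = snd v $ k"
      using eqI[OF mult[OF const[of "idm (I k)"] P[of k]] P[of k]] M
      by (auto simp: M[THEN desing_manifoldD(6)])
    show "snd v $ k ** idm (I k) = snd v $ k"
      using eqI[OF mult[OF P[of k] const[of "idm (I k)"]] P[of k]] M
      by (auto simp: M[THEN desing_manifoldD(7)])
    show "transpose (snd v $ k) = snd v $ k"
      using eqI[OF bounded_linear.has_vector_derivative[OF bounded_linear_transpose P[of k]] P[of k]] M
      by (auto simp: M[THEN desing_manifoldD(4)])
    show "snd v $ k ** snd (c t0) $ k + snd (c t0) $ k ** snd v $ k = snd v $ k"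
      using eqI[OF mult[OF P[of k] P[of k]] P[of k]] M
      by (auto simp: M[THEN desing_manifoldD(5)] add.commute)
    show "mode_prod (fst v) k (snd (c t0) $ k) + mode_prod (fst (c t0)) k (snd v $ k) = 0"
      using eqI[OF mode[OF X P[of k]] const[of 0]] M
      by (auto simp: M[THEN desing_manifoldD(2)] add.commute)
  qed
qed

lemma tangent_space_subset_desing_tangent:
  "tangent_space (desing_manifold I J) x \<subseteq> desing_tangent I x"
proof
  fix v assume "v \<in> tangent_space (desing_manifold I J) x"
  then obtain c e where "e > 0" "c 0 = x" "(c has_vector_derivative v) (at 0)"
    "\<And>t. t \<in> {-e<..<e} \<Longrightarrow> c t \<in> desing_manifold I J"
    unfolding tangent_space_def curve_through_def by blast
  then show "v \<in> desing_tangent I x"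
    using velocity_in_desing_tangent[of c v 0 "{-e<..<e}"] by auto
qed

section \<open>Curves on the manifold induced by lines in the Tucker space\<close>

definition frame_gram where
  "frame_gram J U k = transpose (U $ k) ** U $ k + (mat 1 - idm (J k))"

text \<open>Extends \<open>represented_point\<close> from orthonormal frames to frames of full
  column rank: the second component is the complement of the least-squares projection onto the
  column space.\<close>

definition frame_point ::
  "('d::finite \<Rightarrow> 'n::finite set) \<Rightarrow> ('d \<Rightarrow> 'n set) \<Rightarrow> ('d, 'n) point \<Rightarrow> ('d, 'n) point" where
  "frame_point I J p = (multi_prod (fst p) (snd p),
     \<chi> k. idm (I k) - snd p $ k ** matrix_inv (frame_gram J (snd p) k) ** transpose (snd p $ k))"

lemma frame_point_mem:
  assumes "p \<in> tucker_space I J" "\<And>k. det (frame_gram J (snd p) k) \<noteq> 0"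
  shows "frame_point I J p \<in> desing_manifold I J"
    "snd (frame_point I J p) $ k ** snd p $ k = 0"
proof -
  have U: "snd p $ k \<in> mats (I k) (J k)" for k using assms(1) by (simp add: tucker_space_iff)
  note fr = frame_projection_Gr[OF U, folded frame_gram_def, OF assms(2)]
  show z: "snd (frame_point I J p) $ k ** snd p $ k = 0" for k
    using fr(2)[of k] by (simp add: frame_point_def)
  show "frame_point I J p \<in> desing_manifold I J"
    using fr(1) z U by (auto simp: desing_manifold_iff frame_point_def mats_iff
        intro!: multi_prod_tensors mode_prod_multi_prod_zero)
qed

lemma frame_gram_St:
  assumes "U $ k \<in> St (J k) (I k)" shows "frame_gram J U k = mat 1"
  using assms by (simp add: frame_gram_def St_def)

lemma frame_point_St:
  fixes p :: "('d::finite, 'n::finite) point"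
  assumes "\<And>k. snd p $ k \<in> St (J k) (I k)" shows "frame_point I J p = represented_point I p"
proof -
  have "matrix_inv (mat 1 :: real^'n^'n) = mat 1"
    using matrix_inv_inverse[of "mat 1 :: real^'n^'n"] by simp
  moreover have "frame_gram J (snd p) k = mat 1" for k by (rule frame_gram_St[OF assms])
  ultimately show ?thesis
    by (simp add: frame_point_def represented_point_def case_prod_unfold)
qed

text \<open>At time 0 every \<open>frame_gram\<close> is the identity. By continuity of the
  determinant and finiteness of the set of modes, all of them stay invertible on a common
  interval.\<close>

lemma frame_point_curve:
  assumes p: "p \<in> tucker_space I J" "\<And>k. snd p $ k \<in> St (J k) (I k)" and h: "h \<in> tucker_space I J"
  obtains e where "e > 0" "smooth_on UNIV {-e<..<e} (\<lambda>t. frame_point I J (p + t *\<^sub>R h))"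
    "\<And>t. t \<in> {-e<..<e} \<Longrightarrow> frame_point I J (p + t *\<^sub>R h) \<in> desing_manifold I J"
    "\<And>t k. t \<in> {-e<..<e} \<Longrightarrow> snd (frame_point I J (p + t *\<^sub>R h)) $ k ** snd (p + t *\<^sub>R h) $ k = 0"
proof -
  have line: "Ck_on m UNIV D (\<lambda>t::real. p + t *\<^sub>R h)" for m D
    by (intro Ck_on_add Ck_on_const Ck_on_bilinear[OF bounded_bilinear_scaleR] Ck_on_id)
  have Uk: "Ck_on m UNIV D (\<lambda>t::real. snd (p + t *\<^sub>R h) $ k)" for m D k
    by (intro Ck_on_vec_nth Ck_on_linear[OF bounded_linear_snd] line)
  have gram: "Ck_on m UNIV D (\<lambda>t::real. frame_gram J (snd (p + t *\<^sub>R h)) k)" for m D k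
    unfolding frame_gram_def
    by (intro Ck_on_add Ck_on_matrix_mult Ck_on_const Uk Ck_on_linear[OF bounded_linear_transpose])
  have "continuous_on UNIV (\<lambda>t. det (frame_gram J (snd (p + t *\<^sub>R h)) k))" for k
    by (rule Ck_on_imp_continuous_on[OF Ck_on_det[OF gram[of 0]]])
  then have "open (\<Inter>k. {t. det (frame_gram J (snd (p + t *\<^sub>R h)) k) \<noteq> 0})"
    by (intro open_INT ballI open_Collect_neq continuous_on_const) auto
  moreover have "0 \<in> (\<Inter>k. {t. det (frame_gram J (snd (p + t *\<^sub>R h)) k) \<noteq> 0})"
    by (simp add: frame_gram_St[OF p(2)])
  ultimately obtain e where e: "e > 0" "ball 0 e \<subseteq> (\<Inter>k. {t. det (frame_gram J (snd (p + t *\<^sub>R h)) k) \<noteq> 0})"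
    by (meson openE)
  have "ball 0 e = {-e<..<e}" by (auto simp: dist_real_def)
  then have det: "det (frame_gram J (snd (p + t *\<^sub>R h)) k) \<noteq> 0" if "t \<in> {-e<..<e}" for t k
    using e(2) that by blast
  have "smooth_on UNIV {-e<..<e} (\<lambda>t. frame_point I J (p + t *\<^sub>R h))"
    unfolding smooth_on_def frame_point_def
    by (intro allI Ck_on_Pair Ck_on_multi_prod Ck_on_vec_lambda Ck_on_diff Ck_on_const
        Ck_on_matrix_mult Ck_on_matrix_inv gram det Uk Ck_on_linear[OF bounded_linear_transpose]
        Ck_on_linear[OF bounded_linear_snd] Ck_on_linear[OF bounded_linear_fst] line)
  moreover have "p + t *\<^sub>R h \<in> tucker_space I J" for t
    using p(1) h subspace_tucker_space by (intro subspace_add subspace_mul)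
  ultimately show ?thesis using that e(1) frame_point_mem det by blast
qed

lemma frame_point_velocity:
  assumes p: "p \<in> tucker_space I J" "\<And>k. snd p $ k \<in> St (J k) (I k)" and h: "h \<in> tucker_space I J"
    and v: "((\<lambda>t. frame_point I J (p + t *\<^sub>R h)) has_vector_derivative v) (at 0)"
  shows "v \<in> tangent_space (desing_manifold I J) (represented_point I p)"
proof -
  obtain e where "e > 0" "smooth_on UNIV {-e<..<e} (\<lambda>t. frame_point I J (p + t *\<^sub>R h))"
    "\<And>t. t \<in> {-e<..<e} \<Longrightarrow> frame_point I J (p + t *\<^sub>R h) \<in> desing_manifold I J"
    using frame_point_curve[OF p h] by metis
  then have "curve_through (desing_manifold I J) (represented_point I p) v (\<lambda>t. frame_point I J (p + t *\<^sub>R h))"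
    unfolding curve_through_def using v frame_point_St[OF p(2)] by auto
  then show ?thesis unfolding tangent_space_def by blast
qed

text \<open>
  The frames of the lifted direction satisfy \<open>transpose U ** V = 0\<close>, so that contracting the curve
  with the frames \<open>U\<close> at time \<open>0\<close> gives back its core.
\<close>

definition tangent_lift :: "('d::finite, 'n::finite) point \<Rightarrow> ('d, 'n) point \<Rightarrow> ('d, 'n) point" where
  "tangent_lift p u = (multi_prod (fst u) (\<chi> k. transpose (snd p $ k)),
     \<chi> k. - (snd u $ k ** snd p $ k))"

text \<open>The velocity \<open>v\<close> satisfies the same linear constraints as \<open>u\<close>.
  Differentiating the vanishing product of projection and frame determines its matrix part, and
  differentiating the contraction with the initial frames determines its tensor part.\<close>

lemma tangent_lift:
  assumes p: "p \<in> tucker_space I J" "\<And>k. snd p $ k \<in> St (J k) (I k)"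
    and u: "u \<in> desing_tangent I (represented_point I p)"
  shows "tangent_lift p u \<in> tucker_space I J"
    and "((\<lambda>t. frame_point I J (p + t *\<^sub>R tangent_lift p u)) has_vector_derivative v) (at 0) \<Longrightarrow> v = u"
proof -
  define h where "h = tangent_lift p u"
  define P where "P k = idm (I k) - snd p $ k ** transpose (snd p $ k)" for k
  define U where "U k = snd p $ k" for k
  define D where "D k = snd u $ k" for k
  have U: "idm (I k) ** U k = U k" "U k ** idm (J k) = U k" "transpose (U k) ** U k = idm (J k)" for k
    using p(2)[of k] by (auto simp: St_def mats_iff U_def)
  have UT: "idm (J k) ** transpose (U k) = transpose (U k)" "transpose (U k) ** idm (I k) = transpose (U k)" for k
    using U(1,2)[of k] by (metis matrix_transpose_mul transpose_idm)+
  have x: "represented_point I p = (multi_prod (fst p) (snd p), \<chi> k. P k)"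
    by (simp add: represented_point_def case_prod_unfold P_def)
  have u1: "fst u \<in> tensors I" using u by (simp add: desing_tangent_def)
  have D: "idm (I k) ** D k = D k" "D k ** idm (I k) = D k" "transpose (D k) = D k"
      "D k ** P k + P k ** D k = D k"
      "mode_prod (fst u) k (P k) + mode_prod (multi_prod (fst p) (snd p)) k (D k) = 0" for k
    using u unfolding x desing_tangent_def D_def by (auto simp: mats_iff)
  show hW: "tangent_lift p u \<in> tucker_space I J"
    unfolding tucker_space_iff tangent_lift_def fst_conv snd_conv vec_lambda_beta
  proof (intro conjI allI)
    show "multi_prod (fst u) (\<chi> k. transpose (snd p $ k)) \<in> tensors J"
      using UT by (intro multi_prod_tensors) (simp add: U_def)
    show "- (snd u $ k ** snd p $ k) \<in> mats (I k) (J k)" for k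
      using u p(2)[of k] by (intro mats_neg mats_mult[of _ _ "I k"]) (auto simp: desing_tangent_def St_def)
  qed
  assume v: "((\<lambda>t. frame_point I J (p + t *\<^sub>R tangent_lift p u)) has_vector_derivative v) (at 0)"
  have v': "v \<in> desing_tangent I (represented_point I p)"
    using frame_point_velocity[OF p hW v] tangent_space_subset_desing_tangent by blast
  define E where "E k = snd v $ k" for k
  have E: "idm (I k) ** E k = E k" "E k ** idm (I k) = E k" "transpose (E k) = E k"
      "E k ** P k + P k ** E k = E k"
      "mode_prod (fst v) k (P k) + mode_prod (multi_prod (fst p) (snd p)) k (E k) = 0" for k
    using v' unfolding x desing_tangent_def E_def by (auto simp: mats_iff)
  obtain e where "e > 0"
    and PU0: "\<And>t k. t \<in> {-e<..<e} \<Longrightarrow>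
        snd (frame_point I J (p + t *\<^sub>R tangent_lift p u)) $ k ** snd (p + t *\<^sub>R tangent_lift p u) $ k = 0"
    using frame_point_curve[OF p hW] by metis
  then have e: "open {-e<..<e}" "0 \<in> {-e<..<e}" by auto
  have line: "((\<lambda>t. p + t *\<^sub>R tangent_lift p u) has_vector_derivative tangent_lift p u) (at 0)"
    by (auto intro!: derivative_eq_intros)
  have PP: "P k ** P k = P k" "transpose (P k) = P k" "P k ** U k = 0" "idm (I k) ** P k = P k" for k
  proof -
    show PU: "P k ** U k = 0"
      by (simp add: P_def U_def[symmetric] matrix_diff_rdistrib matrix_mul_assoc[symmetric] U)
    show "transpose (P k) = P k"
      by (simp add: P_def transpose_diff matrix_transpose_mul)
    have "P k ** idm (I k) = P k" "idm (I k) ** P k = P k"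
      by (simp_all add: P_def U_def[symmetric] matrix_diff_rdistrib matrix_diff_ldistrib
          matrix_mul_assoc[symmetric] UT) (simp add: matrix_mul_assoc U)
    then show "idm (I k) ** P k = P k" "P k ** P k = P k"
      using PU by (auto simp: P_def[of k] U_def[symmetric] matrix_diff_ldistrib matrix_mul_assoc)
  qed
  have "E k = D k" for k
  proof -
    have "((\<lambda>t. snd (frame_point I J (p + t *\<^sub>R tangent_lift p u)) $ k ** snd (p + t *\<^sub>R tangent_lift p u) $ k)
        has_vector_derivative snd (frame_point I J (p + 0 *\<^sub>R tangent_lift p u)) $ k ** snd (tangent_lift p u) $ k +
          snd v $ k ** snd (p + 0 *\<^sub>R tangent_lift p u) $ k) (at 0)"
      by (intro bounded_bilinear.has_vector_derivative[OF bounded_bilinear_matrix_matrix_mult]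
          bounded_linear.has_vector_derivative[OF bounded_linear_vec_nth]
          bounded_linear.has_vector_derivative[OF bounded_linear_snd] v line)
    from has_vector_derivative_eq_on_open[OF this has_vector_derivative_const[of 0] e PU0]
    have "P k ** - (D k ** U k) + E k ** U k = 0"
      unfolding scaleR_zero_left add_0_right
      by (simp add: frame_point_St[OF p(2)] x tangent_lift_def D_def E_def U_def)
    then have EU: "E k ** U k = P k ** D k ** U k" by (simp add: matrix_minus_right matrix_mul_assoc)
    \<comment> \<open>The relation \<open>E(4)\<close> says that \<open>E k\<close> has only
      off-diagonal blocks with respect to \<open>P k\<close>. One of them is
      \<open>E k ** U k ** transpose (U k)\<close>, known from \<open>EU\<close>; symmetry then
      gives the other.\<close>
    have "P k ** E k = E k - E k ** P k" using E(4)[of k] by (simp add: eq_diff_eq add.commute)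
    also have "\<dots> = E k ** U k ** transpose (U k)"
      using E by (simp add: P_def U_def[symmetric] matrix_diff_ldistrib matrix_mul_assoc)
    also have "\<dots> = P k ** D k ** U k ** transpose (U k)" by (simp add: EU)
    also have "\<dots> = P k ** D k - P k ** D k ** P k"
      using D by (simp add: P_def[of k] U_def[symmetric] matrix_diff_ldistrib matrix_mul_assoc[symmetric])
    also have "P k ** D k ** P k = 0"
    proof -
      have "P k ** (D k ** P k + P k ** D k) = P k ** D k" by (simp only: D(4))
      then show ?thesis using PP(1)[of k] by (simp add: matrix_add_ldistrib matrix_mul_assoc)
    qed
    finally have PE: "P k ** E k = P k ** D k" by simp
    have "transpose (P k ** E k) = transpose (P k ** D k)" by (simp only: PE)
    then have "E k ** P k = D k ** P k" by (simp add: matrix_transpose_mul PP D E)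
    then show ?thesis using PE D(4)[of k] E(4)[of k] by simp
  qed
  then have snd: "snd v = snd u" by (simp add: vec_eq_iff E_def D_def)
  \<comment> \<open>Since \<open>D k\<close> has only off-diagonal blocks,
    \<open>transpose (U k) ** D k ** U k\<close> vanishes. The moving frame therefore keeps a
    constant product with the initial one.\<close>
  have UV: "transpose (U k) ** (U k + t *\<^sub>R (- (D k ** U k))) = idm (J k)" for k t
  proof -
    have "transpose (U k) ** P k = 0"
      using PP(2,3)[of k] by (metis matrix_transpose_mul times0_right transpose_transpose
          matrix_diff_ldistrib diff_self transpose_diff)
    then have "transpose (U k) ** (D k ** P k + P k ** D k) ** U k = 0"
      using PP(3)[of k] by (simp add: matrix_add_ldistrib matrix_add_rdistrib matrix_mul_assoc)
        (simp add: matrix_mul_assoc[symmetric])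
    then have "transpose (U k) ** (D k ** U k) = 0" using D(4)[of k] by (simp add: matrix_mul_assoc)
    then show ?thesis by (simp add: matrix_diff_ldistrib matrix_scaleR_right U)
  qed
  \<comment> \<open>All frame factors cancel, so the contracted curve is exactly affine in
    \<open>t\<close>, with the core of the lift as its slope.\<close>
  have core: "multi_prod (fst (frame_point I J (p + t *\<^sub>R tangent_lift p u))) (\<chi> k. transpose (snd p $ k)) =
      fst (p + t *\<^sub>R tangent_lift p u)" for t
  proof -
    have "fst (p + t *\<^sub>R tangent_lift p u) \<in> tensors J"
      using p(1) hW by (auto simp: tucker_space_iff intro!: subspace_add[OF subspace_tensors]
          subspace_mul[OF subspace_tensors])
    moreover have "transpose (snd p $ k) ** snd (p + t *\<^sub>R tangent_lift p u) $ k = idm (J k)" for k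
      using UV[of k t] by (simp add: tangent_lift_def U_def D_def)
    ultimately show ?thesis
      by (simp add: frame_point_def multi_prod_multi_prod multi_prod_fixed tensors_iff)
  qed
  have "((\<lambda>t. multi_prod (fst (frame_point I J (p + t *\<^sub>R tangent_lift p u))) (\<chi> k. transpose (snd p $ k)))
      has_vector_derivative multi_prod (fst v) (\<chi> k. transpose (snd p $ k))) (at 0)"
    by (intro bounded_linear.has_vector_derivative[OF linear_multi_prod]
        bounded_linear.has_vector_derivative[OF bounded_linear_fst] v)
  from has_vector_derivative_eq_on_open[OF this
      bounded_linear.has_vector_derivative[OF bounded_linear_fst line] e core]
  have UTv: "multi_prod (fst v) (\<chi> k. transpose (snd p $ k)) = multi_prod (fst u) (\<chi> k. transpose (snd p $ k))"
    by (simp add: tangent_lift_def)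
  \<comment> \<open>Equal matrix parts force equal components along each \<open>P k\<close>, so
    \<open>Y\<close> lies in the span of the frames in every mode. There it is recovered from its
    contraction with the frames, which is zero by \<open>UTv\<close>.\<close>
  define Y where "Y = fst v - fst u"
  have "Y \<in> tensors I"
    using v' u1 unfolding Y_def desing_tangent_def by (auto intro: subspace_diff[OF subspace_tensors])
  moreover have "mode_prod Y k (P k) = 0" for k
    using D(5)[of k] E(5)[of k] \<open>E k = D k\<close> by (simp add: Y_def mode_prod_diff_left)
      (metis add_right_cancel)
  ultimately have "mode_prod Y k (U k ** transpose (U k)) = Y" for k
    using mode_prod_diff_right[of Y k "idm (I k)" "U k ** transpose (U k)"]
    by (simp add: tensors_iff P_def U_def)
  then have "Y = multi_prod Y (\<chi> k. U k ** transpose (U k))" by (simp add: multi_prod_fixed)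
  also have "\<dots> = multi_prod (multi_prod Y (\<chi> k. transpose (snd p $ k))) (snd p)"
    by (simp add: multi_prod_multi_prod U_def)
  also have "multi_prod Y (\<chi> k. transpose (snd p $ k)) = 0"
    using UTv linear_diff[OF bounded_linear.linear[OF linear_multi_prod], of "fst v" "fst u"]
    by (simp add: Y_def)
  finally have "Y = 0"
    using modes_prod_zero[of UNIV "snd p"] by (simp add: modes_prod_UNIV)
  then show "v = u" using snd by (simp add: Y_def prod_eq_iff)
qed

section \<open>The Riemannian gradient\<close>

lemma mat2_mult:
  fixes A :: "real^'n::finite^'n"
  shows "mat 2 ** A = 2 *\<^sub>R A" "A ** mat 2 = 2 *\<^sub>R A"
proof -
  have "mat 2 = 2 *\<^sub>R (mat 1 :: real^'n^'n)" by (simp add: vec_eq_iff mat_def)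
  then show "mat 2 ** A = 2 *\<^sub>R A" "A ** mat 2 = 2 *\<^sub>R A"
    by (simp_all add: matrix_scaleR_left matrix_scaleR_right)
qed

lemma matrix_inv_commute:
  fixes N E :: "real^'n::finite^'n"
  assumes "det N \<noteq> 0" "N ** E = E ** N" shows "E ** matrix_inv N = matrix_inv N ** E"
proof -
  have "E ** matrix_inv N = matrix_inv N ** (N ** E) ** matrix_inv N"
    using matrix_inv_inverse[OF assms(1)] by (simp add: matrix_mul_assoc)
  also have "\<dots> = matrix_inv N ** E ** (N ** matrix_inv N)"
    by (simp add: assms(2) matrix_mul_assoc)
  finally show ?thesis using matrix_inv_inverse[OF assms(1)] by simp
qed

text \<open>
  The normal equations for the tangent vector closest to \<open>(a, 0)\<close> decouple: minimizing over the
  mode \<open>k\<close> gives \<open>A ** (mat 2 + mode_gram k X X) = P ** mode_gram k a X\<close>.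
\<close>

definition grad_factor where
  "grad_factor a x k = snd x $ k ** mode_gram k a (fst x) ** matrix_inv (mat 2 + mode_gram k (fst x) (fst x))"

text \<open>At points of the manifold this is the orthogonal projection of \<open>(a, 0)\<close>
  onto \<open>desing_tangent I x\<close>. With \<open>P k = snd x $ k\<close>, a tangent vector
  \<open>(Y, D)\<close> is described by the blocks \<open>A k = - (P k ** D $ k)\<close>: then
  \<open>D $ k = - (A k + transpose (A k))\<close>, and the component of \<open>Y\<close> along
  \<open>P k\<close> is \<open>mode_prod (fst x) k (A k)\<close>.\<close>

definition desing_grad ::
  "('d::finite \<Rightarrow> 'n::finite set) \<Rightarrow> real^('d \<Rightarrow> 'n) \<Rightarrow> ('d, 'n) point \<Rightarrow> ('d, 'n) point" where
  "desing_grad I a x =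
     (multi_prod a (\<chi> k. idm (I k) - snd x $ k) + (\<Sum>k\<in>UNIV. mode_prod (fst x) k (grad_factor a x k)),
      \<chi> k. - (grad_factor a x k + transpose (grad_factor a x k)))"

lemma Ck_on_desing_grad:
  fixes a :: "real^('d::finite \<Rightarrow> 'n::finite) \<Rightarrow> real^('d \<Rightarrow> 'n)"
  assumes "Ck_on m UNIV UNIV a"
  shows "Ck_on m UNIV UNIV (\<lambda>x. desing_grad I (a (fst x)) x)"
proof -
  have X: "Ck_on m UNIV UNIV (\<lambda>x::('d, 'n) point. fst x)" by (intro Ck_on_linear[OF bounded_linear_fst] Ck_on_id)
  have P: "Ck_on m UNIV UNIV (\<lambda>x::('d, 'n) point. snd x $ k)" for k
    by (intro Ck_on_vec_nth Ck_on_linear[OF bounded_linear_snd] Ck_on_id)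
  have a: "Ck_on m UNIV UNIV (\<lambda>x::('d, 'n) point. a (fst x))" by (rule Ck_on_compose[OF assms X])
  have A: "Ck_on m UNIV UNIV (\<lambda>x::('d, 'n) point. grad_factor (a (fst x)) x k)" for k
    unfolding grad_factor_def
    by (intro Ck_on_matrix_mult P Ck_on_bilinear[OF bilinear_mode_gram] a X Ck_on_matrix_inv Ck_on_add
        Ck_on_const det_mode_gram)
  show ?thesis unfolding desing_grad_def
    by (intro Ck_on_Pair Ck_on_add Ck_on_multi_prod a Ck_on_vec_lambda Ck_on_diff Ck_on_const P
        Ck_on_sum Ck_on_bilinear[OF bilinear_mode_prod] X A Ck_on_minus
        Ck_on_linear[OF bounded_linear_transpose])
qed

lemma grad_factor:
  assumes x: "x \<in> desing_manifold I J"
  shows "idm (I k) ** grad_factor a x k = grad_factor a x k" "grad_factor a x k ** idm (I k) = grad_factor a x k"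
    "snd x $ k ** grad_factor a x k = grad_factor a x k" "grad_factor a x k ** snd x $ k = 0"
    "2 *\<^sub>R grad_factor a x k + grad_factor a x k ** mode_gram k (fst x) (fst x) =
      snd x $ k ** mode_gram k a (fst x)"
    "mode_gram k a (fst x) ** snd x $ k = 0"
proof -
  define X P where "X = fst x" and "P = snd x $ k"
  note M = desing_manifoldD(1)[OF x, folded X_def] desing_manifoldD(2-7)[OF x, where k = k, folded X_def P_def]
  define C where "C = mode_gram k X X"
  define B where "B = mode_gram k a X"
  define N where "N = mat 2 + C"
  have det: "det N \<noteq> 0" by (simp add: N_def C_def det_mode_gram)
  have A: "grad_factor a x k = P ** B ** matrix_inv N"
    by (simp add: grad_factor_def N_def C_def B_def X_def P_def)
  have XI: "mode_prod X k (idm (I k)) = X" using M(1) by (simp add: tensors_iff)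
  have CI: "idm (I k) ** C = C" "C ** idm (I k) = C"
    using mode_gram_mode_prod_left[of k X "idm (I k)" X] mode_gram_mode_prod_right[of k X X "idm (I k)"]
    by (simp_all add: XI C_def)
  have zero: "mode_gram k 0 Y = 0" "mode_gram k Y 0 = 0" for Y :: "real^('a \<Rightarrow> 'b)"
    by (simp_all add: bounded_bilinear.zero_left[OF bilinear_mode_gram]
        bounded_bilinear.zero_right[OF bilinear_mode_gram])
  have CP: "P ** C = 0" "C ** P = 0"
    using mode_gram_mode_prod_left[of k X P X] mode_gram_mode_prod_right[of k X X P]
    by (simp_all add: M zero C_def)
  have BI: "B ** idm (I k) = B"
    using mode_gram_mode_prod_right[of k a X "idm (I k)"] by (simp add: XI B_def)
  have BP: "B ** P = 0"
    using mode_gram_mode_prod_right[of k a X P] by (simp add: M zero B_def)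
  then show "mode_gram k a (fst x) ** snd x $ k = 0" by (simp add: B_def X_def P_def)
  \<comment> \<open>These matrices then commute with the inverse of \<open>N\<close> as well, so
    they can be moved next to \<open>B\<close>, where \<open>BI\<close> and \<open>BP\<close>
    apply.\<close>
  have "N ** idm (I k) = idm (I k) ** N" "N ** P = P ** N"
    by (simp_all add: N_def matrix_add_ldistrib matrix_add_rdistrib mat2_mult CI CP)
  note comm = this[THEN matrix_inv_commute[OF det]]
  show "idm (I k) ** grad_factor a x k = grad_factor a x k"
    by (simp add: A matrix_mul_assoc M)
  show "snd x $ k ** grad_factor a x k = grad_factor a x k"
    by (simp add: A matrix_mul_assoc M flip: P_def)
  have "grad_factor a x k ** idm (I k) = P ** (B ** idm (I k)) ** matrix_inv N"
    by (simp add: A matrix_mul_assoc[symmetric] comm(1)[symmetric])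
  then show "grad_factor a x k ** idm (I k) = grad_factor a x k" by (simp add: BI A)
  have "grad_factor a x k ** P = P ** (B ** P) ** matrix_inv N"
    by (simp add: A matrix_mul_assoc[symmetric] comm(2)[symmetric])
  then have "grad_factor a x k ** P = 0" by (simp add: BP)
  then show "grad_factor a x k ** snd x $ k = 0" by (simp add: P_def)
  have "grad_factor a x k ** N = P ** B ** (matrix_inv N ** N)" by (simp add: A matrix_mul_assoc)
  then have "grad_factor a x k ** N = P ** B" by (simp add: matrix_inv_inverse(2)[OF det])
  then show "2 *\<^sub>R grad_factor a x k + grad_factor a x k ** mode_gram k (fst x) (fst x) =
      snd x $ k ** mode_gram k a (fst x)"
    by (simp add: N_def matrix_add_ldistrib mat2_mult C_def B_def X_def P_def)
qed

lemma desing_grad_tangent: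
  assumes x: "x \<in> desing_manifold I J"
  shows "desing_grad I a x \<in> desing_tangent I x"
proof -
  define X P where "X = fst x" and "P k = snd x $ k" for k
  note M = desing_manifoldD[OF x, folded X_def P_def]
  define A where "A = grad_factor a x"
  note A = grad_factor[OF x, where a = a, folded X_def P_def A_def]
  define Y where "Y = multi_prod a (\<chi> k. idm (I k) - P k) + (\<Sum>k\<in>UNIV. mode_prod X k (A k))"
  have g: "desing_grad I a x = (Y, \<chi> k. - (A k + transpose (A k)))"
    by (simp add: desing_grad_def Y_def X_def P_def A_def)
  have AT: "transpose (A k) ** P k = transpose (A k)" "P k ** transpose (A k) = 0" for k
    using A(3)[of k] A(4)[of k] M(4)[of k] 
    by (metis matrix_transpose_mul, metis matrix_transpose_mul times0_left transpose_transpose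
        transpose_iff mode_prod_zero_left matrix_diff_ldistrib diff_self transpose_diff)
  have IP: "idm (I k) ** (idm (I k) - P k) = idm (I k) - P k" for k
    by (simp add: matrix_diff_ldistrib M)
  \<comment> \<open>In its own mode \<open>P k\<close> fixes \<open>A k\<close>; past a factor in
    another mode it reaches \<open>X\<close> and annihilates it.\<close>
  have XA: "mode_prod (mode_prod X l (A l)) k (P k) = (if k = l then mode_prod X k (A k) else 0)" for k l
    by (cases "k = l") (simp_all add: mode_prod_mode_prod A mode_prod_commute[of l k] M mode_prod_zero_left)
  have XI: "mode_prod X k (idm (I k)) = X" for k using M(1) by (simp add: tensors_iff)
  show ?thesis
    unfolding desing_tangent_def mem_Collect_eq g fst_conv snd_conv vec_lambda_beta
      X_def[symmetric] P_def[symmetric]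
  proof (intro conjI allI)
    have "mode_prod (mode_prod X l (A l)) k (idm (I k)) = mode_prod X l (A l)" for k l
      by (cases "k = l") (simp_all add: mode_prod_mode_prod A mode_prod_commute[of l k] XI)
    then have "mode_prod X l (A l) \<in> tensors I" for l by (simp add: tensors_iff)
    moreover have "multi_prod a (\<chi> k. idm (I k) - P k) \<in> tensors I"
      by (intro multi_prod_tensors) (simp add: IP)
    ultimately show "Y \<in> tensors I" unfolding Y_def
      by (intro subspace_add[OF subspace_tensors] subspace_sum[OF subspace_tensors])
  next
    fix k
    have "A k \<in> mats (I k) (I k)" using A by (simp add: mats_iff)
    then show "- (A k + transpose (A k)) \<in> mats (I k) (I k)" by (intro mats_neg mats_add transpose_mats)
    show "transpose (- (A k + transpose (A k))) = - (A k + transpose (A k))"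
      by (simp add: transpose_minus transpose_add transpose_diff)
    show "- (A k + transpose (A k)) ** P k + P k ** - (A k + transpose (A k)) = - (A k + transpose (A k))"
      by (simp add: matrix_minus_left matrix_minus_right matrix_diff_ldistrib matrix_diff_rdistrib A AT)
    have "mode_prod Y k (P k) = mode_prod X k (A k)"
    proof -
      have "mode_prod (multi_prod a (\<chi> k. idm (I k) - P k)) k (P k) = 0"
        by (rule mode_prod_multi_prod_zero) (simp add: matrix_diff_ldistrib M)
      then show ?thesis
        by (simp add: Y_def mode_prod_add_left mode_prod_sum_left XA)
    qed
    moreover have "mode_prod X k (transpose (A k)) = 0"
      using mode_prod_mode_prod[of X k "P k" "transpose (A k)"] by (simp add: M AT mode_prod_zero_left)
    ultimately show "mode_prod Y k (P k) + mode_prod X k (- (A k + transpose (A k))) = 0"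
      by (simp add: mode_prod_minus_right mode_prod_diff_right)
  qed
qed

text \<open>Tangency replaces each component of \<open>Y\<close> along \<open>P k\<close> by
  \<open>- mode_prod X k (D k)\<close>, which a second projection in another mode annihilates. So
  \<open>Y\<close> splits into a core part and one part per mode, and each mode reduces to the
  normal equation for \<open>A k\<close>.\<close>

lemma inner_desing_grad:
  assumes x: "x \<in> desing_manifold I J" and v: "v \<in> desing_tangent I x"
  shows "desing_grad I a x \<bullet> v = a \<bullet> fst v"
proof -
  define X P where "X = fst x" and "P k = snd x $ k" for k
  define Y D where "Y = fst v" and "D k = snd v $ k" for k
  note M = desing_manifoldD[OF x, folded X_def P_def]
  define A where "A = grad_factor a x"
  define B where "B k = mode_gram k a X" for k
  define Q where "Q = (\<chi> k. idm (I k) - P k)"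
  note A = grad_factor[OF x, where a = a, folded X_def P_def A_def, folded B_def]
  have Y: "Y \<in> tensors I" and D: "transpose (D k) = D k" "D k ** P k + P k ** D k = D k"
    and YP': "mode_prod Y k (P k) + mode_prod X k (D k) = 0" for k
    using v by (auto simp: desing_tangent_def Y_def D_def X_def P_def)
  have YP: "mode_prod Y k (P k) = - mode_prod X k (D k)" for k
    using YP'[of k] by (simp add: eq_neg_iff_add_eq_0)
  have dec: "Y = multi_prod Y Q + (\<Sum>k\<in>UNIV. mode_prod Y k ((\<chi> k. P k) $ k))"
    unfolding modes_prod_UNIV[symmetric]
  proof (rule modes_prod_decompose)
    show "mode_prod Y k (Q $ k) + mode_prod Y k ((\<chi> k. P k) $ k) = Y" for k
      using Y by (simp add: Q_def mode_prod_diff_right tensors_iff)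
    show "mode_prod (mode_prod Y k ((\<chi> k. P k) $ k)) l ((\<chi> k. P k) $ l) = 0" if "k \<noteq> l" for k l
      using mode_prod_commute[OF that, of X "D k" "P l"]
      by (simp add: YP mode_prod_minus_left M mode_prod_zero_left)
  qed
  have "(\<chi> k. transpose (Q $ k)) = Q" by (simp add: Q_def vec_eq_iff[of _ Q] transpose_diff M)
  then have aQ: "multi_prod a Q \<bullet> Y = a \<bullet> multi_prod Y Q" by (simp add: multi_prod_adjoint)
  have k: "mode_prod X k (A k) \<bullet> Y - (A k + transpose (A k)) \<bullet> D k = a \<bullet> mode_prod Y k (P k)" for k
  proof -
    have "mode_prod X k (A k) \<bullet> Y = mode_prod (mode_prod X k (A k)) k (P k) \<bullet> Y"
      by (simp add: mode_prod_mode_prod A)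
    also have "\<dots> = - (mode_prod X k (A k) \<bullet> mode_prod X k (D k))"
      by (simp add: mode_prod_adjoint[of "mode_prod X k (A k)"] M YP)
    also have "\<dots> = - ((A k ** mode_gram k X X) \<bullet> D k)"
      by (simp add: inner_mode_prod mode_gram_mode_prod_left)
    finally have 1: "mode_prod X k (A k) \<bullet> Y = - ((A k ** mode_gram k X X) \<bullet> D k)" .
    have "transpose (A k) \<bullet> D k = A k \<bullet> D k"
      using inner_transpose[of "A k" "D k"] by (simp add: D)
    then have "mode_prod X k (A k) \<bullet> Y - (A k + transpose (A k)) \<bullet> D k =
        - ((2 *\<^sub>R A k + A k ** mode_gram k X X) \<bullet> D k)"
      by (simp add: 1 inner_add_left)
    also have "\<dots> = - (B k \<bullet> (P k ** D k))"
      by (simp add: A matrix_inner_mult_left M)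
    also have "B k \<bullet> (P k ** D k) = B k \<bullet> D k"
    proof -
      have "B k \<bullet> (D k ** P k) = 0"
        using matrix_inner_mult_right[of "B k" "P k" "D k"] by (simp add: A M)
      then have "B k \<bullet> (D k ** P k + P k ** D k) = B k \<bullet> (P k ** D k)" by (simp add: inner_add_right)
      then show ?thesis by (simp add: D)
    qed
    finally show ?thesis by (simp add: YP inner_mode_prod B_def)
  qed
  have "desing_grad I a x \<bullet> v = multi_prod a Q \<bullet> Y + (\<Sum>k\<in>UNIV. mode_prod X k (A k) \<bullet> Y)
      + (\<Sum>k\<in>UNIV. - (A k + transpose (A k)) \<bullet> D k)"
    by (cases v) (simp add: desing_grad_def Q_def X_def P_def A_def Y_def D_def inner_add_left
        inner_sum_left inner_vec_def[of "\<chi> k. - _ k"] inner_vec_def[where 'a = "real^'b^'b"])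
  also have "\<dots> = a \<bullet> multi_prod Y Q + (\<Sum>k\<in>UNIV. mode_prod X k (A k) \<bullet> Y - (A k + transpose (A k)) \<bullet> D k)"
    by (simp add: aQ sum_subtractf sum_negf del: minus_add_distrib)
  also have "\<dots> = a \<bullet> (multi_prod Y Q + (\<Sum>k\<in>UNIV. mode_prod Y k ((\<chi> k. P k) $ k)))"
    by (simp add: k inner_add_right inner_sum_right)
  finally show ?thesis using dec by (simp add: Y_def)
qed

section \<open>Comparison of the two parametrizations\<close>

lemma Ck_on_Suc_0_derivative:
  assumes "Ck_on (Suc 0) UNIV UNIV F"
  obtains F' where "\<And>x. (F has_derivative F' x) (at x)"
  using assms by auto

lemma smooth_curve_derivatives:
  assumes "smooth_on UNIV {-e<..<e} c" "e > 0"
  obtains c' c'' where "\<And>t. t \<in> {-e<..<e} \<Longrightarrow> (c has_vector_derivative c' t) (at t)"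
    "\<And>t. t \<in> {-e<..<e} \<Longrightarrow> (c' has_vector_derivative c'' t) (at t)"
proof -
  let ?S = "{-e<..<e}"
  have *: "\<exists>d'. (\<forall>t\<in>?S. (d has_vector_derivative d' t) (at t)) \<and> Ck_on m UNIV ?S d'"
    if "Ck_on (Suc m) UNIV ?S d" for m and d :: "real \<Rightarrow> 'a"
  proof -
    obtain F' where F: "\<forall>t\<in>?S. (d has_derivative F' t) (at t within ?S)"
      "\<forall>h. Ck_on m UNIV ?S (\<lambda>t. F' t h)"
      using \<open>Ck_on (Suc m) UNIV ?S d\<close> unfolding Ck_on.simps by auto
    have "(d has_vector_derivative F' t 1) (at t)" if "t \<in> ?S" for t
    proof -
      have d: "(d has_derivative F' t) (at t)" using F(1) that by (metis at_within_open open_greaterThanLessThan)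
      have "F' t s = s *\<^sub>R F' t 1" for s
        using linear_cmul[OF has_derivative_linear[OF d], of s 1] by simp
      then have "F' t = (\<lambda>s. s *\<^sub>R F' t 1)" by blast
      with d show ?thesis unfolding has_vector_derivative_def by metis
    qed
    then show ?thesis using F(2) by (intro exI[of _ "\<lambda>t. F' t 1"]) blast
  qed
  have "Ck_on (Suc (Suc 0)) UNIV ?S c" using assms(1) by (simp only: smooth_on_def)
  from *[OF this] obtain c' where c': "\<forall>t\<in>?S. (c has_vector_derivative c' t) (at t)" "Ck_on (Suc 0) UNIV ?S c'"
    by blast
  from *[OF c'(2)] obtain c'' where "\<forall>t\<in>?S. (c' has_vector_derivative c'' t) (at t)" by blast
  with c' that show ?thesis by blast
qed

lemma tangent_space_represented_point:
  assumes p: "p \<in> tucker_space I J" "\<And>k. snd p $ k \<in> St (J k) (I k)"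
  shows "tangent_space (desing_manifold I J) (represented_point I p) = desing_tangent I (represented_point I p)"
proof
  show "desing_tangent I (represented_point I p) \<subseteq> tangent_space (desing_manifold I J) (represented_point I p)"
  proof
    fix u assume u: "u \<in> desing_tangent I (represented_point I p)"
    note h = tangent_lift(1)[OF p u]
    obtain e where e: "e > 0" "smooth_on UNIV {-e<..<e} (\<lambda>t. frame_point I J (p + t *\<^sub>R tangent_lift p u))"
      using frame_point_curve[OF p h] by metis
    obtain c' where "\<And>t. t \<in> {-e<..<e} \<Longrightarrow>
        ((\<lambda>t. frame_point I J (p + t *\<^sub>R tangent_lift p u)) has_vector_derivative c' t) (at t)"
      using smooth_curve_derivatives[OF e(2,1)] by metis
    then have c: "((\<lambda>t. frame_point I J (p + t *\<^sub>R tangent_lift p u)) has_vector_derivative c' 0) (at 0)"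
      using e(1) by simp
    show "u \<in> tangent_space (desing_manifold I J) (represented_point I p)"
      using frame_point_velocity[OF p h c] tangent_lift(2)[OF p u c] by simp
  qed
qed (rule tangent_space_subset_desing_tangent)

text \<open>Annihilation by every \<open>snd x $ k\<close> means that the tensor is fixed by
  \<open>U k ** transpose (U k)\<close> in every mode. Its contraction with the transposed frames
  therefore serves as the core.\<close>

lemma desing_manifold_represented:
  assumes x: "x \<in> desing_manifold I J" and "\<And>k. card (J k) \<le> card (I k)"
  obtains p where "p \<in> tucker_space I J" "\<And>k. snd p $ k \<in> St (J k) (I k)" "represented_point I p = x"
proof -
  have "\<exists>U. U \<in> St (J k) (I k) \<and> snd x $ k = idm (I k) - U ** transpose U" for k
    using Gr_orthonormal_frame[of "snd x $ k" "I k" "J k"] x assms(2) by (metis desing_manifold_iff)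
  then obtain U where U: "\<And>k. U k \<in> St (J k) (I k)" "\<And>k. snd x $ k = idm (I k) - U k ** transpose (U k)"
    by metis
  define p where "p = (multi_prod (fst x) (\<chi> k. transpose (U k)), \<chi> k. U k)"
  have "idm (J k) ** transpose (U k) = transpose (U k)" for k
    using U(1)[of k] by (intro idm_mult[of _ _ "I k"] transpose_mats) (simp add: St_def)
  then have "p \<in> tucker_space I J"
    using U(1) by (auto simp: tucker_space_iff p_def St_def intro!: multi_prod_tensors)
  moreover have "mode_prod (fst x) k (U k ** transpose (U k)) = fst x" for k
  proof -
    have "mode_prod (fst x) k (idm (I k) - U k ** transpose (U k)) = 0"
      using desing_manifoldD(2)[OF x] by (simp add: U(2)[symmetric])
    then show ?thesis
      using desing_manifoldD(1)[OF x] by (simp add: mode_prod_diff_right tensors_iff)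
  qed
  then have "represented_point I p = x"
    by (simp add: represented_point_def p_def multi_prod_multi_prod multi_prod_fixed prod_eq_iff
        vec_eq_iff[of _ "snd x"] U(2))
  ultimately show ?thesis using that U(1) by (simp add: p_def)
qed

text \<open>Composing \<open>f\<close> with the linear map that zeroes all entries off the index
  sets gives a function on the full space, to which ordinary derivatives and chain rules
  apply.\<close>

lemma smooth_on_tensors_extension:
  fixes f :: "real^('d::finite \<Rightarrow> 'n::finite) \<Rightarrow> real"
  assumes "smooth_on (tensors I) (tensors I) f"
  obtains F where "\<And>m. Ck_on m UNIV UNIV F" "\<And>X. X \<in> tensors I \<Longrightarrow> F X = f X"
proof -
  define L where "L = (\<lambda>X::real^('d \<Rightarrow> 'n). multi_prod X (\<chi> k. idm (I k)))"
  have L: "bounded_linear L" unfolding L_def by (rule linear_multi_prod)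
  have "range L \<subseteq> tensors I" by (auto simp: L_def intro!: multi_prod_tensors)
  with assms have "Ck_on m UNIV UNIV (\<lambda>X. f (L X))" for m
    by (intro Ck_on_compose_projection[OF L]) (auto simp: smooth_on_def)
  moreover have "X \<in> tensors I \<Longrightarrow> L X = X" for X
    by (simp add: L_def multi_prod_fixed tensors_iff)
  ultimately show ?thesis using that[of "\<lambda>X. f (L X)"] by simp
qed

lemma tucker_map_tensors:
  assumes "p \<in> tucker_space I J" shows "tucker_map p \<in> tensors I"
  using assms by (auto simp: tucker_space_iff tucker_map_def case_prod_unfold mats_iff intro!: multi_prod_tensors)

lemma tucker_gradient:
  fixes f :: "real^('d::finite \<Rightarrow> 'n::finite) \<Rightarrow> real"
  assumes "smooth_on (tensors I) (tensors I) f"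
  obtains G H where
    "\<And>x. x \<in> tucker_space I J \<Longrightarrow> (f \<circ> tucker_map has_derivative (\<lambda>h. G x \<bullet> h)) (at x within tucker_space I J)"
    "\<And>x. x \<in> tucker_space I J \<Longrightarrow> (G has_derivative H x) (at x within tucker_space I J)"
proof -
  obtain F where F: "\<And>m. Ck_on m UNIV UNIV F" "\<And>X. X \<in> tensors I \<Longrightarrow> F X = f X"
    using smooth_on_tensors_extension[OF assms] by metis
  have "Ck_on (Suc (Suc 0)) UNIV UNIV (\<lambda>p::('d, 'n) point. F (multi_prod (fst p) (snd p)))"
    by (intro Ck_on_compose[OF F(1)] Ck_on_multi_prod Ck_on_linear[OF bounded_linear_fst]
        Ck_on_linear[OF bounded_linear_snd] Ck_on_id)
  then obtain G where
    G: "\<And>x. ((\<lambda>p::('d, 'n) point. F (multi_prod (fst p) (snd p))) has_derivative (\<lambda>h. G x \<bullet> h)) (at x)"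
    "Ck_on (Suc 0) UNIV UNIV G"
    by (rule Ck_on_gradient) blast
  obtain H where "\<And>x. (G has_derivative H x) (at x)" by (rule Ck_on_Suc_0_derivative[OF G(2)]) blast
  moreover have "(f \<circ> tucker_map has_derivative (\<lambda>h. G x \<bullet> h)) (at x within tucker_space I J)"
    if "x \<in> tucker_space I J" for x
  proof (rule has_derivative_transform[OF that])
    show "((\<lambda>p::('d, 'n) point. F (multi_prod (fst p) (snd p))) has_derivative (\<lambda>h. G x \<bullet> h))
        (at x within tucker_space I J)"
      using G(1) has_derivative_at_withinI by blast
    show "(f \<circ> tucker_map) p = F (multi_prod (fst p) (snd p))" if "p \<in> tucker_space I J" for p
      using F(2)[OF tucker_map_tensors[OF that]] by (simp add: tucker_map_def case_prod_unfold)
  qed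
  ultimately show ?thesis using that[of G H] has_derivative_at_withinI by blast
qed

lemma line_derivatives:
  assumes W: "subspace W"
    and g: "\<And>x. x \<in> W \<Longrightarrow> (g has_derivative (\<lambda>h. G x \<bullet> h)) (at x within W)"
    and G: "\<And>x. x \<in> W \<Longrightarrow> (G has_derivative H x) (at x within W)"
    and "x \<in> W" "h \<in> W"
  shows "((\<lambda>t. g (x + t *\<^sub>R h)) has_vector_derivative G (x + t *\<^sub>R h) \<bullet> h) (at t)"
    "((\<lambda>t. G (x + t *\<^sub>R h) \<bullet> h) has_vector_derivative h \<bullet> H x h) (at 0)"
proof -
  have "x + t *\<^sub>R h \<in> W" for t using assms by (intro subspace_add subspace_mul)
  then show "((\<lambda>t. g (x + t *\<^sub>R h)) has_vector_derivative G (x + t *\<^sub>R h) \<bullet> h) (at t)"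
    by (intro has_derivative_within_subspace_line[OF _ W] g assms)
  have "((\<lambda>t. G (x + t *\<^sub>R h)) has_vector_derivative H x h) (at 0)"
    using assms by (intro has_derivative_within_subspace_line[OF _ W]) auto
  from bounded_linear.has_vector_derivative[OF bounded_linear_inner_left this, of h]
  show "((\<lambda>t. G (x + t *\<^sub>R h) \<bullet> h) has_vector_derivative h \<bullet> H x h) (at 0)"
    by (subst inner_commute)
qed

lemma second_order_stationary_represented_point:
  fixes f :: "real^('d::finite \<Rightarrow> 'n::finite) \<Rightarrow> real"
  assumes ranks: "\<And>k. card (J k) \<le> card (I k)"
    and smooth: "smooth_on (tensors I) (tensors I) f"
    and p: "p \<in> tucker_space I J" "\<And>k. snd p $ k \<in> St (J k) (I k)"
  shows "riem_second_order_stationary (desing_manifold I J) (f \<circ> desing_map) (represented_point I p) \<longleftrightarrow>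
    second_order_stationary (tucker_space I J) (f \<circ> tucker_map) p"
proof -
  let ?M = "desing_manifold I J" and ?W = "tucker_space I J" and ?x = "represented_point I p"
  note W = subspace_tucker_space[of I J]
  obtain F where F: "\<And>m. Ck_on m UNIV UNIV F" "\<And>X. X \<in> tensors I \<Longrightarrow> F X = f X"
    by (rule smooth_on_tensors_extension[OF smooth]) blast
  obtain a where a: "\<And>X. (F has_derivative (\<lambda>h. a X \<bullet> h)) (at X)" "Ck_on (Suc 0) UNIV UNIV a"
    by (rule Ck_on_gradient[OF F(1)[of "Suc (Suc 0)"]]) blast
  define w where "w y = desing_grad I (a (fst y)) y" for y
  have "Ck_on (Suc 0) UNIV UNIV w" unfolding w_def by (rule Ck_on_desing_grad[OF a(2)])
  then obtain K where K: "\<And>y. (w has_derivative K y) (at y)"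
    by (rule Ck_on_Suc_0_derivative) blast
  obtain G H where
    G: "\<And>x. x \<in> ?W \<Longrightarrow> (f \<circ> tucker_map has_derivative (\<lambda>h. G x \<bullet> h)) (at x within ?W)" and
    H: "\<And>x. x \<in> ?W \<Longrightarrow> (G has_derivative H x) (at x within ?W)"
    by (rule tucker_gradient[OF smooth, of J]) blast
  have T: "tangent_space ?M y = desing_tangent I y" if y: "y \<in> ?M" for y
  proof -
    obtain q where "q \<in> ?W" "\<And>k. snd q $ k \<in> St (J k) (I k)" "represented_point I q = y"
      by (rule desing_manifold_represented[OF y ranks]) blast
    then show ?thesis using tangent_space_represented_point[of q I J] by simp
  qed
  have gM: "(f \<circ> desing_map has_derivative (\<lambda>h. a (fst y) \<bullet> fst h)) (at y within ?M)" if "y \<in> ?M" for y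
  proof (rule has_derivative_transform[OF that])
    show "((\<lambda>y::('d, 'n) point. F (fst y)) has_derivative (\<lambda>h. a (fst y) \<bullet> fst h)) (at y within ?M)"
      by (rule has_derivative_compose[OF bounded_linear_imp_has_derivative[OF bounded_linear_fst] a(1)])
    show "(f \<circ> desing_map) z = F (fst z)" if "z \<in> ?M" for z
      using F(2) desing_manifoldD(1)[OF that] by (simp add: desing_map_def case_prod_unfold)
  qed
  have wT: "w y \<bullet> v = a (fst y) \<bullet> fst v" if "y \<in> ?M" "v \<in> desing_tangent I y" for y v
    unfolding w_def by (rule inner_desing_grad[OF that])
  have riem: "riem_second_order_stationary ?M (f \<circ> desing_map) ?x \<longleftrightarrow>
      ?x \<in> ?M \<and> w ?x = 0 \<and> (\<forall>u\<in>tangent_space ?M ?x. 0 \<le> u \<bullet> K ?x u)"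
  proof (rule riem_second_order_stationary_iff[where w = w and H = K and D = "\<lambda>y h. a (fst y) \<bullet> fst h"])
    show "(f \<circ> desing_map has_derivative (\<lambda>h. a (fst y) \<bullet> fst h)) (at y within ?M)" if "y \<in> ?M" for y
      using that by (rule gM)
    show "subspace (tangent_space ?M y)" if "y \<in> ?M" for y
      by (simp add: T[OF that] subspace_desing_tangent)
    show "w y \<in> tangent_space ?M y" if "y \<in> ?M" for y
      unfolding T[OF that] w_def by (rule desing_grad_tangent[OF that])
    show "w y \<bullet> v = a (fst y) \<bullet> fst v" if "y \<in> ?M" "v \<in> tangent_space ?M y" for y v
      using wT that T by simp
    show "(w has_derivative K y) (at y within ?M)" if "y \<in> ?M" for y
      using K by (rule has_derivative_at_withinI)
  qed
  have "frame_gram J (snd p) k = mat 1" for k by (rule frame_gram_St[OF p(2)])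
  then have x: "?x \<in> ?M"
    using frame_point_mem(1)[OF p(1)] frame_point_St[of p J I, OF p(2)] by simp
  \<comment> \<open>The derivative statement is carried along so that \<open>lift\<close> can
    identify this \<open>v\<close> with a prescribed tangent vector.\<close>
  have key: "\<exists>v. v \<in> desing_tangent I ?x \<and> G p \<bullet> h = w ?x \<bullet> v \<and> (w ?x = 0 \<longrightarrow> h \<bullet> H p h = v \<bullet> K ?x v) \<and>
      ((\<lambda>t. frame_point I J (p + t *\<^sub>R h)) has_vector_derivative v) (at 0)" if h: "h \<in> ?W" for h
  proof -
    define c where "c t = frame_point I J (p + t *\<^sub>R h)" for t
    obtain e where e: "e > 0" "smooth_on UNIV {-e<..<e} c" "\<And>t. t \<in> {-e<..<e} \<Longrightarrow> c t \<in> ?M"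
      unfolding c_def using frame_point_curve[OF p h] by metis
    obtain c' c'' where c: "\<And>t. t \<in> {-e<..<e} \<Longrightarrow> (c has_vector_derivative c' t) (at t)"
      "\<And>t. t \<in> {-e<..<e} \<Longrightarrow> (c' has_vector_derivative c'' t) (at t)"
      using smooth_curve_derivatives[OF e(2,1)] by metis
    have c0: "c 0 = ?x" by (simp add: c_def frame_point_St[of p J I, OF p(2)])
    have S: "open {-e<..<e}" "0 \<in> {-e<..<e}" using e(1) by auto
    have vT: "c' t \<in> desing_tangent I (c t)" if "t \<in> {-e<..<e}" for t
      by (rule velocity_in_desing_tangent[OF c(1)[OF that] S(1) that e(3)])
    have line: "p + t *\<^sub>R h \<in> ?W" for t using p(1) h W by (intro subspace_add subspace_mul)
    have eq: "G (p + t *\<^sub>R h) \<bullet> h = w (c t) \<bullet> c' t" if t: "t \<in> {-e<..<e}" for t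
    proof -
      have "((\<lambda>s. fst (c s)) has_derivative (\<lambda>s. s *\<^sub>R fst (c' t))) (at t)"
        using bounded_linear.has_vector_derivative[OF bounded_linear_fst c(1)[OF t]]
        unfolding has_vector_derivative_def .
      from has_derivative_compose[OF this a(1)]
      have Fc: "((\<lambda>s. F (fst (c s))) has_vector_derivative a (fst (c t)) \<bullet> fst (c' t)) (at t)"
        unfolding has_vector_derivative_def by simp
      \<comment> \<open>The tensor component of \<open>frame_point\<close> is the Tucker product
        itself, free of inverses, so the costs agree at every time.\<close>
      have cost: "(\<lambda>s. F (fst (c s))) = (\<lambda>s. (f \<circ> tucker_map) (p + s *\<^sub>R h))"
        using F(2)[OF tucker_map_tensors[OF line]]
        by (simp add: fun_eq_iff c_def frame_point_def tucker_map_def case_prod_unfold)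
      have "a (fst (c t)) \<bullet> fst (c' t) = G (p + t *\<^sub>R h) \<bullet> h"
        by (rule vector_derivative_unique_at[OF Fc[unfolded cost] line_derivatives(1)[OF W G H p(1) h]])
      then show ?thesis using wT[OF e(3)[OF t] vT[OF t]] by simp
    qed
    have "(c has_derivative (\<lambda>s. s *\<^sub>R c' 0)) (at 0)"
      using c(1)[OF S(2)] unfolding has_vector_derivative_def .
    from has_derivative_compose[OF this K] have "((\<lambda>t. w (c t)) has_derivative (\<lambda>s. K ?x (s *\<^sub>R c' 0))) (at 0)"
      by (simp add: c0)
    moreover have "linear (K ?x)" using K has_derivative_linear by blast
    ultimately have "((\<lambda>t. w (c t)) has_vector_derivative K ?x (c' 0)) (at 0)"
      unfolding has_vector_derivative_def by (simp add: linear_cmul)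
    from bounded_bilinear.has_vector_derivative[OF bounded_bilinear_inner this c(2)[OF S(2)]]
    have "((\<lambda>t. w (c t) \<bullet> c' t) has_vector_derivative (w ?x \<bullet> c'' 0 + K ?x (c' 0) \<bullet> c' 0)) (at 0)"
      by (simp add: c0)
    from has_vector_derivative_eq_on_open[OF line_derivatives(2)[OF W G H p(1) h] this S eq]
    have "h \<bullet> H p h = w ?x \<bullet> c'' 0 + c' 0 \<bullet> K ?x (c' 0)" by (simp add: inner_commute)
    then show ?thesis
      using vT[OF S(2)] eq[OF S(2)] c(1)[OF S(2)] by (intro exI[of _ "c' 0"]) (simp add: c0 flip: c_def)
  qed
  have lift: "\<exists>h\<in>?W. G p \<bullet> h = w ?x \<bullet> u \<and> (w ?x = 0 \<longrightarrow> h \<bullet> H p h = u \<bullet> K ?x u)"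
    if u: "u \<in> desing_tangent I ?x" for u
  proof -
    from key[OF tangent_lift(1)[OF p u]] obtain v where
      v: "G p \<bullet> tangent_lift p u = w ?x \<bullet> v"
        "w ?x = 0 \<longrightarrow> tangent_lift p u \<bullet> H p (tangent_lift p u) = v \<bullet> K ?x v" and
      d: "((\<lambda>t. frame_point I J (p + t *\<^sub>R tangent_lift p u)) has_vector_derivative v) (at 0)"
      by blast
    have "v = u" by (rule tangent_lift(2)[OF p u d])
    with v tangent_lift(1)[OF p u] show ?thesis by blast
  qed
  have "w ?x = 0 \<longleftrightarrow> (\<forall>h\<in>?W. G p \<bullet> h = 0)"
  proof
    assume "w ?x = 0"
    show "\<forall>h\<in>?W. G p \<bullet> h = 0"
    proof
      fix h assume "h \<in> ?W"
      from key[OF this] \<open>w ?x = 0\<close> show "G p \<bullet> h = 0" by auto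
    qed
  next
    assume *: "\<forall>h\<in>?W. G p \<bullet> h = 0"
    \<comment> \<open>Lifting the gradient itself expresses its squared norm as a directional
      derivative of the Tucker cost, which is zero.\<close>
    have "w ?x \<in> desing_tangent I ?x" unfolding w_def by (rule desing_grad_tangent[OF x])
    from lift[OF this] * show "w ?x = 0" by auto
  qed
  moreover have "(\<forall>u\<in>desing_tangent I ?x. 0 \<le> u \<bullet> K ?x u) \<longleftrightarrow> (\<forall>h\<in>?W. 0 \<le> h \<bullet> H p h)" if "w ?x = 0"
  proof
    assume *: "\<forall>u\<in>desing_tangent I ?x. 0 \<le> u \<bullet> K ?x u"
    show "\<forall>h\<in>?W. 0 \<le> h \<bullet> H p h"
    proof
      fix h assume "h \<in> ?W"
      from key[OF this] that * show "0 \<le> h \<bullet> H p h" by auto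
    qed
  next
    assume *: "\<forall>h\<in>?W. 0 \<le> h \<bullet> H p h"
    show "\<forall>u\<in>desing_tangent I ?x. 0 \<le> u \<bullet> K ?x u"
    proof
      fix u assume "u \<in> desing_tangent I ?x"
      from lift[OF this] that * show "0 \<le> u \<bullet> K ?x u" by auto
    qed
  qed
  ultimately show ?thesis
    using riem second_order_stationary_iff[OF W G H, of p] p(1) x T[OF x] by auto
qed

section \<open>Change of frames and the comparison of the stationary sets\<close>

lemma is_inverse_on_unique:
  assumes "is_inverse_on B R S" "is_inverse_on B R S'" shows "S = S'"
proof -
  have S: "S \<in> mats B B" "S ** R = idm B" and S': "S' \<in> mats B B" "R ** S' = idm B"
    using assms unfolding is_inverse_on_def by blast+
  have "S = S ** (R ** S')" unfolding S'(2) by (rule mult_idm[OF S(1), symmetric])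
  also have "\<dots> = S'" unfolding matrix_mul_assoc S(2) by (rule idm_mult[OF S'(1)])
  finally show ?thesis .
qed

lemma is_inverse_on_inv_on:
  assumes "R \<in> GL B" shows "is_inverse_on B R (inv_on B R)"
proof -
  from assms obtain S where S: "is_inverse_on B R S"
    unfolding GL_def by blast
  show ?thesis
    unfolding inv_on_def by (rule theI[where P = "is_inverse_on B R", OF S]) (rule is_inverse_on_unique[OF _ S])
qed

lemma orthonormalizes_idm:
  assumes "\<And>k. U $ k \<in> St (J k) (I k)" shows "orthonormalizes I J U (\<chi> k. idm (J k))"
proof -
  have "U $ k ** idm (J k) = U $ k" for k
    using assms[of k] unfolding St_def by (blast intro: mult_idm)
  moreover have "idm (J k) \<in> GL (J k)" for k
    unfolding GL_def is_inverse_on_def using idm_mats[of "J k"] idm_idem[of "J k"] by blast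
  ultimately show ?thesis using assms by (simp add: orthonormalizes_def)
qed

theorem theorem3:
  fixes I J :: "'d::finite \<Rightarrow> 'n::finite set"
    and f :: "real^('d \<Rightarrow> 'n) \<Rightarrow> real"
  assumes ranks: "\<And>k. 1 \<le> card (J k)" "\<And>k. card (J k) \<le> card (I k)"
    and smooth: "smooth_on (tensors I) (tensors I) f"
  defines "S2 \<equiv> {x. riem_second_order_stationary (desing_manifold I J) (f \<circ> desing_map) x}"
    and "S2_tucker \<equiv> {p. second_order_stationary (tucker_space I J) (f \<circ> tucker_map) p}"
  shows "(\<forall>G U R. (G, U) \<in> S2_tucker \<and> orthonormalizes I J U R \<longrightarrow>
            represented_point I
              (multi_prod G (\<chi> k. inv_on (J k) (R $ k)), \<chi> k. U $ k ** R $ k) \<in> S2)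
       \<and> desing_map ` S2 =
           tucker_map ` {(G, U). (G, U) \<in> S2_tucker \<and> (\<exists>R. orthonormalizes I J U R)}"
proof -
  let ?W = "tucker_space I J"
  note W = subspace_tucker_space[of I J]
  have change: "represented_point I p' \<in> S2 \<and> tucker_map p' = tucker_map (C, U)"
    if CU: "(C, U) \<in> S2_tucker" and R: "orthonormalizes I J U R"
      and p': "p' = (multi_prod C (\<chi> k. inv_on (J k) (R $ k)), \<chi> k. U $ k ** R $ k)" for C U R p'
  proof -
    define S where "S k = inv_on (J k) (R $ k)" for k
    have RS: "R $ k ** S k = idm (J k)" "S k ** R $ k = idm (J k)"
      "idm (J k) ** S k = S k" "S k ** idm (J k) = S k" 
      "idm (J k) ** R $ k = R $ k" "R $ k ** idm (J k) = R $ k" for k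
      using is_inverse_on_inv_on[of "R $ k" "J k"] R
      by (auto simp: orthonormalizes_def is_inverse_on_def S_def GL_def mats_iff)
    have SM: "S k \<in> mats (J k) (J k)" and RM: "R $ k \<in> mats (J k) (J k)" for k
      by (simp_all add: mats_iff RS)
    have St: "snd p' $ k \<in> St (J k) (I k)" for k using R by (simp add: p' orthonormalizes_def)
    \<comment> \<open>This linear map undoes the normalization: it sends \<open>p'\<close> back to
      \<open>(C, U)\<close> and preserves the Tucker tensor. Gradient and Hessian form at
      \<open>p'\<close> are therefore the pullbacks along \<open>\<sigma>\<close> of those at
      \<open>(C, U)\<close>.\<close>
    define \<sigma> where "\<sigma> q = (multi_prod (fst q) R, \<chi> k. snd q $ k ** S k)" for q :: "('d, 'n) point"
    have \<sigma>W: "\<sigma> q \<in> ?W" if "q \<in> ?W" for q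
      unfolding tucker_space_iff \<sigma>_def fst_conv snd_conv vec_lambda_beta
      using that SM by (auto simp: RS tucker_space_iff intro!: multi_prod_tensors mats_mult[of _ _ "J _"])
    have \<sigma>map: "tucker_map (\<sigma> q) = tucker_map q" if "q \<in> ?W" for q
    proof -
      have "(\<chi> k. snd q $ k ** S k ** R $ k) = snd q"
        using that by (simp add: matrix_mul_assoc[symmetric] RS tucker_space_iff mats_iff vec_eq_iff[of _ "snd q"])
      then show ?thesis by (simp add: \<sigma>_def tucker_map_def case_prod_unfold multi_prod_multi_prod)
    qed
    have lin: "\<sigma> (q + t *\<^sub>R h) = \<sigma> q + t *\<^sub>R \<sigma> h" for q h t
    proof -
      note L = bounded_linear.linear[OF linear_multi_prod, of R]
      have "multi_prod (X + t *\<^sub>R Y) R = multi_prod X R + t *\<^sub>R multi_prod Y R" for X Y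
        by (simp only: linear_add[OF L] linear_cmul[OF L])
      moreover have "(\<chi> k. snd (q + t *\<^sub>R h) $ k ** S k) = (\<chi> k. snd q $ k ** S k) + t *\<^sub>R (\<chi> k. snd h $ k ** S k)"
        by (subst vec_eq_iff) (simp add: matrix_add_rdistrib matrix_scaleR_left)
      ultimately show ?thesis by (simp add: \<sigma>_def)
    qed
    have CW: "(C, U) \<in> ?W" using CU by (simp add: S2_tucker_def second_order_stationary_def)
    have p'W: "p' \<in> ?W"
      unfolding tucker_space_iff p' fst_conv snd_conv vec_lambda_beta
      using CW RM by (auto simp: RS S_def[symmetric] tucker_space_iff intro!: multi_prod_tensors mats_mult[of _ _ "J _"])
    have \<sigma>p': "\<sigma> p' = (C, U)"
    proof -
      have "multi_prod C (\<chi> k. R $ k ** S k) = C"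
        using CW by (intro multi_prod_fixed) (simp add: RS tucker_space_iff tensors_iff)
      moreover have "(\<chi> k. U $ k ** R $ k ** S k) = U"
        using CW by (simp add: matrix_mul_assoc[symmetric] RS tucker_space_iff mats_iff vec_eq_iff[of _ U])
      ultimately show ?thesis by (simp add: \<sigma>_def p' S_def[symmetric] multi_prod_multi_prod)
    qed
    obtain G H where
      G: "\<And>x. x \<in> ?W \<Longrightarrow> (f \<circ> tucker_map has_derivative (\<lambda>h. G x \<bullet> h)) (at x within ?W)" and
      H: "\<And>x. x \<in> ?W \<Longrightarrow> (G has_derivative H x) (at x within ?W)"
      by (rule tucker_gradient[OF smooth, of J]) blast
    note iff = second_order_stationary_iff[OF W G H]
    have "G p' \<bullet> h = G (C, U) \<bullet> \<sigma> h \<and> h \<bullet> H p' h = \<sigma> h \<bullet> H (C, U) (\<sigma> h)" if h: "h \<in> ?W" for h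
    proof -
      note d1 = line_derivatives[OF W G H p'W h] and d2 = line_derivatives[OF W G H CW \<sigma>W[OF h]]
      have "p' + t *\<^sub>R h \<in> ?W" for t using p'W h W by (intro subspace_add subspace_mul)
      from \<sigma>map[OF this]
      \<comment> \<open>By linearity \<open>\<sigma>\<close> maps the line through \<open>p'\<close>
        to a line through \<open>(C, U)\<close>. The cost is the same function of \<open>t\<close>
        on both, so its first two derivatives can be compared.\<close>
      have cost: "(\<lambda>t. (f \<circ> tucker_map) (p' + t *\<^sub>R h)) = (\<lambda>t. (f \<circ> tucker_map) ((C, U) + t *\<^sub>R \<sigma> h))"
        by (simp add: fun_eq_iff lin \<sigma>p')
      have eq: "G (p' + t *\<^sub>R h) \<bullet> h = G ((C, U) + t *\<^sub>R \<sigma> h) \<bullet> \<sigma> h" for t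
        by (rule vector_derivative_unique_at[OF d1(1)[of t, unfolded cost] d2(1)])
      have "h \<bullet> H p' h = \<sigma> h \<bullet> H (C, U) (\<sigma> h)"
        using d1(2) d2(2) unfolding eq by (rule vector_derivative_unique_at)
      then show ?thesis using eq[of 0] by simp
    qed
    then have "second_order_stationary ?W (f \<circ> tucker_map) p'"
      using CU iff[of p'] iff[of "(C, U)"] p'W \<sigma>W by (simp add: S2_tucker_def)
    then have "represented_point I p' \<in> S2"
      using second_order_stationary_represented_point[OF ranks(2) smooth p'W St] by (simp add: S2_def)
    moreover have "tucker_map p' = tucker_map (C, U)" using \<sigma>map[OF p'W] \<sigma>p' by simp
    ultimately show ?thesis by blast
  qed
  have map: "desing_map (represented_point I p) = tucker_map p" for p :: "('d, 'n) point"
    by (simp add: desing_map_def represented_point_def tucker_map_def case_prod_unfold)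
  have "desing_map ` S2 \<subseteq> tucker_map ` {(C, U). (C, U) \<in> S2_tucker \<and> (\<exists>R. orthonormalizes I J U R)}"
  proof
    fix X assume "X \<in> desing_map ` S2"
    then obtain x where x: "x \<in> S2" "X = desing_map x" by blast
    then have "x \<in> desing_manifold I J" by (simp add: S2_def riem_second_order_stationary_def)
    then obtain p where p: "p \<in> ?W" "\<And>k. snd p $ k \<in> St (J k) (I k)" "represented_point I p = x"
      by (rule desing_manifold_represented[OF _ ranks(2)]) blast
    have "p \<in> S2_tucker"
      using second_order_stationary_represented_point[OF ranks(2) smooth p(1,2)] x(1) p(3)
      by (simp add: S2_def S2_tucker_def)
    \<comment> \<open>The frames of \<open>p\<close> are already orthonormal, so the identity
      matrices witness the required \<open>R\<close>.\<close>
    moreover have "orthonormalizes I J (snd p) (\<chi> k. idm (J k))"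
      by (rule orthonormalizes_idm[of "snd p" J I, OF p(2)])
    ultimately have "p \<in> {(C, U). (C, U) \<in> S2_tucker \<and> (\<exists>R. orthonormalizes I J U R)}"
      unfolding mem_Collect_eq case_prod_unfold by auto
    moreover have "X = tucker_map p" using map[of p] p(3) x(2) by simp
    ultimately show "X \<in> tucker_map ` {(C, U). (C, U) \<in> S2_tucker \<and> (\<exists>R. orthonormalizes I J U R)}"
      by (rule image_eqI[rotated])
  qed
  moreover have "tucker_map ` {(C, U). (C, U) \<in> S2_tucker \<and> (\<exists>R. orthonormalizes I J U R)} \<subseteq> desing_map ` S2"
  proof clarify
    fix C U R assume "(C, U) \<in> S2_tucker" "orthonormalizes I J U R"
    from change[OF this refl] obtain q where "represented_point I q \<in> S2" "tucker_map q = tucker_map (C, U)"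
      by blast
    then show "tucker_map (C, U) \<in> desing_map ` S2"
      unfolding map[symmetric] using imageI[of "represented_point I q" S2 desing_map] by simp
  qed
  ultimately have "desing_map ` S2 =
      tucker_map ` {(C, U). (C, U) \<in> S2_tucker \<and> (\<exists>R. orthonormalizes I J U R)}" by (rule subset_antisym)
  moreover have "represented_point I
      (multi_prod C (\<chi> k. inv_on (J k) (R $ k)), \<chi> k. U $ k ** R $ k) \<in> S2"
    if "(C, U) \<in> S2_tucker" "orthonormalizes I J U R" for C U R
    using change[OF that refl] by (rule conjunct1)
  ultimately show ?thesis by simp
qed

end
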